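(* Let $r\ge 1$, and let $(a(t))_{t\in\mathbb Z}$ and $(c_j(k))_{k\in\mathbb Z}$, $1\le j\le r$, be arbitrary sequences of nonzero complex numbers (generic, so that no denominators below vanish). Define lower-triangular matrices $f=(f_{\mathbf n\mathbf k})_{\mathbf n,\mathbf k\in\mathbb Z^r}$ and $g=(g_{\mathbf k\mathbf l})_{\mathbf k,\mathbf l\in\mathbb Z^r}$ by $$f_{\mathbf n\mathbf k}=\frac{\prod_{j=1}^r\prod_{t=|\mathbf k|}^{|\mathbf n|-1}\theta\big(c_j(k_j)a(t)^\pm\big)}{\prod_{i,j=1}^r\prod_{t=k_i+1}^{n_i}\theta\big(c_j(k_j)c_i(t)^\pm\big)}\qquad(\mathbf n\ge\mathbf k)$$ and $$g_{\mathbf k\mathbf l}=\prod_{1\le i<j\le r}\frac{\theta\big(c_j(l_j)c_i(l_i)^\pm\big)}{\theta\big(c_j(k_j)c_i(k_i)^\pm\big)}\prod_{j=1}^r\frac{c_j(k_j)^j\,\theta\big(c_j(l_j)a(|\mathbf l|)^\pm\big)}{c_j(l_j)^j\,\theta\big(c_j(k_j)a(|\mathbf k|)^\pm\big)}\cdot\frac{\prod_{j=1}^r\prod_{t=|\mathbf l|+1}^{|\mathbf k|}\theta\big(c_j(k_j)a(t)^\pm\big)}{\prod_{i,j=1}^r\prod_{t=l_i}^{k_i-1}\theta\big(c_j(k_j)c_i(t)^\pm\big)}\qquad(\mathbf k\ge\mathbf l),$$ all other entries being $0$. Then $f$ and $g$ are mutually inverse.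
   Context: Fix a complex number $p$ with $|p|<1$. For $x\in\mathbb C\setminus\{0\}$ put $\theta(x)=\theta(x;p)=\prod_{j=0}^\infty(1-p^jx)(1-p^{j+1}/x)$, and write $\theta(xy^\pm)=\theta(xy)\theta(x/y)$. For $\mathbf k=(k_1,\dots,k_r)\in\mathbb Z^r$ write $|\mathbf k|=k_1+\cdots+k_r$; $\mathbf n\ge\mathbf k$ means $n_i\ge k_i$ for all $i$. A matrix $(f_{\mathbf n\mathbf k})_{\mathbf n,\mathbf k\in\mathbb Z^r}$ is lower-triangular if $f_{\mathbf n\mathbf k}=0$ unless $\mathbf n\ge\mathbf k$. Lower-triangular matrices $f,g$ are mutually inverse if $\sum_{\mathbf l\le\mathbf k\le\mathbf n}f_{\mathbf n\mathbf k}g_{\mathbf k\mathbf l}=\delta_{\mathbf n\mathbf l}$ for all $\mathbf n,\mathbf l$ (equivalently $\sum_{\mathbf l\le\mathbf k\le\mathbf n}g_{\mathbf n\mathbf k}f_{\mathbf k\mathbf l}=\delta_{\mathbf n\mathbf l}$). Empty products are $1$. Parameters are assumed generic so that no denominator vanishes. *)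

theory Defs
  imports "HOL-Analysis.Analysis"
begin

subsection \<open>The theta function\<close>

definition theta :: "complex \<Rightarrow> complex \<Rightarrow> complex" where
  "theta p x = (\<Prod>j. (1 - p ^ j * x) * (1 - p ^ (j + 1) / x))"

text \<open>\<open>theta_pm p x y\<close> is what is usually written $\theta(x y^\pm; p)$.\<close>

definition theta_pm :: "complex \<Rightarrow> complex \<Rightarrow> complex \<Rightarrow> complex" where
  "theta_pm p x y = theta p (x * y) * theta p (x / y)"

text \<open>
  \<^const>\<open>prodinf\<close> is only meaningful for a convergent product; here convergence holds
  for every \<open>x\<close>, including those where finitely many factors (and hence the product) vanish.
\<close>

lemma theta_convergent_prod:
  fixes p x :: complex
  assumes "norm p < 1"
  shows "convergent_prod (\<lambda>j. (1 - p ^ j * x) * (1 - p ^ (j + 1) / x))"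
proof -
  have geo: "summable (\<lambda>j. norm p ^ j)"
    using assms by (simp add: summable_geometric)
  have majorant: "summable (\<lambda>j. (norm x + norm p / norm x + norm p) * norm p ^ j)"
    by (intro summable_mult geo)
  have bound: "norm ((1 - p ^ j * x) * (1 - p ^ (j + 1) / x) - 1)
      \<le> (norm x + norm p / norm x + norm p) * norm p ^ j" for j
  proof -
    define u where "u = p ^ j * x"
    define v where "v = p ^ (j + 1) / x"
    have u: "norm u = norm x * norm p ^ j"
      by (simp add: u_def norm_mult norm_power)
    have v: "norm v = norm p / norm x * norm p ^ j"
      by (simp add: v_def norm_mult norm_divide norm_power)
    have uv: "norm (u * v) \<le> norm p * norm p ^ j"
    proof (cases "x = 0")
      case True
      then show ?thesis by (simp add: u_def)
    next
      case False
      then have "norm (u * v) = (norm p * norm p ^ j) * norm p ^ j"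
        unfolding norm_mult u v by simp
      also have "\<dots> \<le> norm p * norm p ^ j"
        using assms by (intro mult_left_le power_le_one) auto
      finally show ?thesis .
    qed
    have "(1 - u) * (1 - v) - 1 = (- u - v) + u * v"
      by (simp add: algebra_simps)
    then have "norm ((1 - u) * (1 - v) - 1) \<le> norm (- u - v) + norm (u * v)"
      by (simp only: norm_triangle_ineq)
    moreover have "norm (- u - v) \<le> norm u + norm v"
      using norm_triangle_ineq4[of "- u" v] by simp
    ultimately have "norm ((1 - u) * (1 - v) - 1)
        \<le> norm x * norm p ^ j + norm p / norm x * norm p ^ j + norm p * norm p ^ j"
      using u v uv by linarith
    then show ?thesis
      unfolding u_def v_def distrib_right .
  qed
  have "summable (\<lambda>j. norm ((1 - p ^ j * x) * (1 - p ^ (j + 1) / x) - 1))"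
  proof (rule summable_comparison_test'[OF majorant, where N = 0])
    show "norm (norm ((1 - p ^ j * x) * (1 - p ^ (j + 1) / x) - 1))
        \<le> (norm x + norm p / norm x + norm p) * norm p ^ j" for j
      unfolding real_norm_def abs_norm_cancel by (rule bound)
  qed
  then show ?thesis
    by (intro abs_convergent_prod_imp_convergent_prod)
      (simp only: abs_convergent_prod_conv_summable)
qed


subsection \<open>Matrices indexed by $\mathbb{Z}^r$\<close>

text \<open>
  $\mathbb{Z}^r$ consists of the functions on $\{1,\dots,r\}$, extended by \<^const>\<open>undefined\<close>
  outside, so that HOL equality of two elements is equality of their components.
\<close>

definition Zvec :: "nat \<Rightarrow> (nat \<Rightarrow> int) set" where
  "Zvec r = {1..r} \<rightarrow>\<^sub>E (UNIV :: int set)"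

definition weight :: "nat \<Rightarrow> (nat \<Rightarrow> int) \<Rightarrow> int" where
  "weight r k = (\<Sum>i=1..r. k i)"

definition vle :: "nat \<Rightarrow> (nat \<Rightarrow> int) \<Rightarrow> (nat \<Rightarrow> int) \<Rightarrow> bool" where
  "vle r k n \<longleftrightarrow> (\<forall>i\<in>{1..r}. k i \<le> n i)"

definition vinterval :: "nat \<Rightarrow> (nat \<Rightarrow> int) \<Rightarrow> (nat \<Rightarrow> int) \<Rightarrow> (nat \<Rightarrow> int) set" where
  "vinterval r l n = {k \<in> Zvec r. vle r l k \<and> vle r k n}"

lemma vinterval_eq_PiE: "vinterval r l n = (\<Pi>\<^sub>E i\<in>{1..r}. {l i..n i})"
  by (auto simp: vinterval_def Zvec_def vle_def PiE_iff extensional_def)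

lemma finite_vinterval: "finite (vinterval r l n)"
  by (simp add: vinterval_eq_PiE finite_PiE)

type_synonym zmatrix = "(nat \<Rightarrow> int) \<Rightarrow> (nat \<Rightarrow> int) \<Rightarrow> complex"

definition lower_triangular :: "nat \<Rightarrow> zmatrix \<Rightarrow> bool" where
  "lower_triangular r f \<longleftrightarrow> (\<forall>n\<in>Zvec r. \<forall>k\<in>Zvec r. \<not> vle r k n \<longrightarrow> f n k = 0)"

definition mutually_inverse :: "nat \<Rightarrow> zmatrix \<Rightarrow> zmatrix \<Rightarrow> bool" where
  "mutually_inverse r f g \<longleftrightarrow>
     lower_triangular r f \<and> lower_triangular r g \<and>
     (\<forall>n\<in>Zvec r. \<forall>l\<in>Zvec r.
        (\<Sum>k\<in>vinterval r l n. f n k * g k l) = (if n = l then 1 else 0)) \<and>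
     (\<forall>n\<in>Zvec r. \<forall>l\<in>Zvec r.
        (\<Sum>k\<in>vinterval r l n. g n k * f k l) = (if n = l then 1 else 0))"


subsection \<open>The two matrices\<close>

definition f_mat ::
  "nat \<Rightarrow> complex \<Rightarrow> (int \<Rightarrow> complex) \<Rightarrow> (nat \<Rightarrow> int \<Rightarrow> complex) \<Rightarrow> zmatrix" where
  "f_mat r p a c n k =
     (if vle r k n then
        (\<Prod>j=1..r. \<Prod>t=weight r k..weight r n - 1. theta_pm p (c j (k j)) (a t)) /
        (\<Prod>i=1..r. \<Prod>j=1..r. \<Prod>t=k i + 1..n i. theta_pm p (c j (k j)) (c i t))
      else 0)"

definition g_mat ::
  "nat \<Rightarrow> complex \<Rightarrow> (int \<Rightarrow> complex) \<Rightarrow> (nat \<Rightarrow> int \<Rightarrow> complex) \<Rightarrow> zmatrix" where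
  "g_mat r p a c k l =
     (if vle r l k then
        (\<Prod>j=1..r. \<Prod>i=1..<j.
           theta_pm p (c j (l j)) (c i (l i)) / theta_pm p (c j (k j)) (c i (k i))) *
        (\<Prod>j=1..r.
           (c j (k j) ^ j * theta_pm p (c j (l j)) (a (weight r l))) /
           (c j (l j) ^ j * theta_pm p (c j (k j)) (a (weight r k)))) *
        ((\<Prod>j=1..r. \<Prod>t=weight r l + 1..weight r k. theta_pm p (c j (k j)) (a t)) /
         (\<Prod>i=1..r. \<Prod>j=1..r. \<Prod>t=l i..k i - 1. theta_pm p (c j (k j)) (c i t)))
      else 0)"

text \<open>
  Genericity: no theta factor occurring in a denominator of an entry of either matrix vanishes.
  The first condition concerns \<^const>\<open>f_mat\<close>, the other three concern \<^const>\<open>g_mat\<close>.  Only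
  factors that really occur are excluded; e.g. for $r = 1$ the last-but-one condition
  involves only $\theta(c_1(k) a(k)^\pm)$.
\<close>

definition no_zero_denominators ::
  "nat \<Rightarrow> complex \<Rightarrow> (int \<Rightarrow> complex) \<Rightarrow> (nat \<Rightarrow> int \<Rightarrow> complex) \<Rightarrow> bool" where
  "no_zero_denominators r p a c \<longleftrightarrow>
     (\<forall>n\<in>Zvec r. \<forall>k\<in>Zvec r. vle r k n \<longrightarrow>
        (\<forall>i\<in>{1..r}. \<forall>j\<in>{1..r}. \<forall>t\<in>{k i + 1..n i}. theta_pm p (c j (k j)) (c i t) \<noteq> 0)) \<and>
     (\<forall>k\<in>Zvec r. \<forall>j\<in>{1..r}. \<forall>i\<in>{1..<j}. theta_pm p (c j (k j)) (c i (k i)) \<noteq> 0) \<and>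
     (\<forall>k\<in>Zvec r. \<forall>j\<in>{1..r}. theta_pm p (c j (k j)) (a (weight r k)) \<noteq> 0) \<and>
     (\<forall>k\<in>Zvec r. \<forall>l\<in>Zvec r. vle r l k \<longrightarrow>
        (\<forall>i\<in>{1..r}. \<forall>j\<in>{1..r}. \<forall>t\<in>{l i..k i - 1}. theta_pm p (c j (k j)) (c i t) \<noteq> 0))"

end

theory Submission
  imports Defs
begin

text \<open>
  The theta function enters only through $\theta(xy^\pm) = x\,(A(x)B(y) - B(x)A(y))$ for suitable
  functions $A, B$, which follows from the Jacobi triple product by splitting the double series of
  $\theta(xy)\theta(x/y)$ according to the parity of the exponent of $x$.  Writing
  $w(x,y) = A(x)B(y) - B(x)A(y)$, all powers of the $c_j$ cancel, and $f_{nk} g_{kl}$ becomes a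
  constant times
  \[ \prod_{i<j} w(c_j(k_j), c_i(k_i)) \prod_j \varphi_j(k_j), \qquad
     \varphi_j(m) = \frac{\prod_{|l|<t<|n|} w(c_j(m), a(t))}{\prod_{(i,t)\ne(j,m)} w(c_j(m), c_i(t))}, \]
  where $(i,t)$ runs over all nodes with $l_i \le t \le n_i$.  As a function of its first argument the
  product over pairs is a product of $r-1$ factors $w$, so a partial fraction identity replaces
  the sum over $k_1$ by minus the sum over the nodes of the other blocks $j \ge 2$.
  That contribution is antisymmetric in the node and $k_j$, hence vanishes after summation over $k_j$.
  The other order of multiplication follows since $f$ is triangular with unit diagonal.
\<close>

subsection \<open>The Jacobi triple product\<close>

text \<open>The q-Pochhammer symbol (p;p)_m.\<close>

definition qpoch :: "complex \<Rightarrow> nat \<Rightarrow> complex" where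
  "qpoch p m = (\<Prod>j<m. 1 - p ^ Suc j)"

text \<open>
  The value $0$ at negative arguments makes the recurrence \<open>rqpoch_pred\<close> hold for all integers and
  cuts off the coefficients of the finite Jacobi triple product at $|n| > N$.
\<close>

definition rqpoch :: "complex \<Rightarrow> int \<Rightarrow> complex" where
  "rqpoch p m = (if m < 0 then 0 else 1 / qpoch p (nat m))"

definition tri :: "int \<Rightarrow> int" where
  "tri n = n * (n - 1) div 2"

text \<open>The division in \<open>tri\<close> is exact, so identities between its values are
  checked after doubling.\<close>

lemma two_tri: "2 * tri n = n * (n - 1)"
  by (simp add: tri_def)

lemma tri_Suc: "tri (n + 1) = tri n + n"
  using two_tri[of n] two_tri[of "n + 1"] by (simp add: algebra_simps)

lemma one_minus_power_nonzero:
  fixes p :: complex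
  assumes "norm p < 1"
  shows "1 - p ^ Suc j \<noteq> 0"
proof
  assume "1 - p ^ Suc j = 0"
  then have "norm (p ^ Suc j) = 1" by (metis eq_iff_diff_eq_0 norm_one)
  moreover have "norm (p ^ Suc j) < 1"
    using assms unfolding norm_power by (cases "p = 0") (auto intro!: power_Suc_less_one simp del: power_Suc)
  ultimately show False by simp
qed

lemma qpoch_nonzero: "norm p < 1 \<Longrightarrow> qpoch p m \<noteq> 0"
  using one_minus_power_nonzero by (auto simp: qpoch_def)

lemma rqpoch_pred:
  assumes "norm p < 1"
  shows "rqpoch p (m - 1) = (1 - p powi m) * rqpoch p m"
proof (cases "m \<ge> 1")
  case True
  define k where "k = nat (m - 1)"
  have m: "m = int (Suc k)" using True by (simp add: k_def)
  have "1 - p * p ^ k \<noteq> 0"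
    using one_minus_power_nonzero[OF assms, of k] by simp
  then show ?thesis
    using qpoch_nonzero[OF assms]
    by (simp add: m rqpoch_def qpoch_def power_int_def nat_add_distrib field_simps)
next
  case False
  then show ?thesis by (cases "m = 0") (auto simp: rqpoch_def)
qed

text \<open>The bracket is the Gaussian binomial coefficient of 2N over N+n in base p.\<close>

definition jtp_coeff :: "complex \<Rightarrow> nat \<Rightarrow> int \<Rightarrow> complex" where
  "jtp_coeff p N n = (-1) powi n * p powi tri n *
     (qpoch p (2 * N) * rqpoch p (int N + n) * rqpoch p (int N - n))"

text \<open>Multiplication by (1 - p^N x)(1 - p^(N+1)/x) = 1 + p^(2N+1) - p^N x - p^(N+1)/x dictates
  this recurrence. In terms of u and v all coefficients share the factor s Q R R', and a polynomial
  identity in u, v and 1/p remains.\<close>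

lemma jtp_coeff_Suc:
  assumes p: "norm p < 1" "p \<noteq> 0"
  shows "jtp_coeff p (Suc N) n = (1 + p ^ (2 * N + 1)) * jtp_coeff p N n
     - p ^ N * jtp_coeff p N (n - 1) - p ^ Suc N * jtp_coeff p N (n + 1)"
proof -
  define s where "s = (-1) powi n * p powi tri n"
  define a where "a = int N + 1 + n"
  define b where "b = int N + 1 - n"
  define u where "u = p powi a"
  define v where "v = p powi b"
  define R where "R = rqpoch p a"
  define R' where "R' = rqpoch p b"
  define Q where "Q = qpoch p (2 * N)"
  have uv: "u * v = p ^ (2 * N + 2)"
  proof -
    have "u * v = p powi (a + b)" using p by (simp add: u_def v_def power_int_add)
    also have "a + b = int (2 * N + 2)" by (simp add: a_def b_def)
    finally show ?thesis by (simp only: power_int_of_nat)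
  qed
  have s1: "(-1) powi (n - 1) * p powi tri (n - 1) = - s * p powi (1 - n)"
  proof -
    have "tri (n - 1) = tri n + (1 - n)" using tri_Suc[of "n - 1"] by simp
    then show ?thesis using p by (simp add: s_def power_int_add power_int_diff)
  qed
  have s2: "(-1) powi (n + 1) * p powi tri (n + 1) = - s * p powi n"
    using p by (simp add: s_def power_int_add tri_Suc)
  have Ra: "rqpoch p (a - 1) = (1 - u) * R" "rqpoch p (a - 2) = (1 - u / p) * (1 - u) * R"
    using rqpoch_pred[OF p(1), of a] rqpoch_pred[OF p(1), of "a - 1"] p
    by (simp_all add: u_def R_def power_int_diff)
  have Rb: "rqpoch p (b - 1) = (1 - v) * R'" "rqpoch p (b - 2) = (1 - v / p) * (1 - v) * R'"
    using rqpoch_pred[OF p(1), of b] rqpoch_pred[OF p(1), of "b - 1"] p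
    by (simp_all add: v_def R'_def power_int_diff)
  have c0: "jtp_coeff p N n = s * (Q * ((1 - u) * R) * ((1 - v) * R'))"
    unfolding jtp_coeff_def s_def[symmetric] Q_def[symmetric] Ra(1)[symmetric] Rb(1)[symmetric]
    by (simp add: a_def b_def)
  have c1: "jtp_coeff p N (n - 1) = - s * p powi (1 - n) * (Q * ((1 - u / p) * (1 - u) * R) * R')"
    unfolding jtp_coeff_def s1 Q_def[symmetric] Ra(2)[symmetric] R'_def
    by (simp add: a_def b_def algebra_simps)
  have c2: "jtp_coeff p N (n + 1) = - s * p powi n * (Q * R * ((1 - v / p) * (1 - v) * R'))"
    unfolding jtp_coeff_def s2 Q_def[symmetric] Rb(2)[symmetric] R_def
    by (simp add: a_def b_def algebra_simps)
  have Q: "qpoch p (2 * Suc N) = Q * (1 - u * v / p) * (1 - u * v)"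
    using p unfolding uv by (simp add: Q_def qpoch_def)
  have c3: "jtp_coeff p (Suc N) n = s * (Q * (1 - u * v / p) * (1 - u * v) * R * R')"
    unfolding jtp_coeff_def s_def[symmetric] Q R_def R'_def a_def b_def by (simp add: algebra_simps)
  have pv: "p ^ N * p powi (1 - n) = v"
    using p by (simp add: v_def b_def power_int_add power_int_diff)
  have pu: "p ^ Suc N * p powi n = u"
    using p by (simp add: u_def a_def power_int_add)
  have pp: "p ^ (2 * N + 1) = u * v / p"
    using p unfolding uv by simp
  have ring: "A - P * (- s * B * E) - P' * (- s * B' * E') = A + (P * B) * (s * E) + (P' * B') * (s * E')"
    for A P P' B B' E E' :: complex by simp
  have "(1 + p ^ (2 * N + 1)) * jtp_coeff p N n
     - p ^ N * jtp_coeff p N (n - 1) - p ^ Suc N * jtp_coeff p N (n + 1) =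
     (1 + u * v / p) * (s * (Q * ((1 - u) * R) * ((1 - v) * R')))
     + (p ^ N * p powi (1 - n)) * (s * (Q * ((1 - u / p) * (1 - u) * R) * R'))
     + (p ^ Suc N * p powi n) * (s * (Q * R * ((1 - v / p) * (1 - v) * R')))"
    unfolding c0 c1 c2 pp by (rule ring)
  also have "\<dots> = jtp_coeff p (Suc N) n"
    unfolding pv pu c3 using p(2) by (simp add: field_simps)
  finally show ?thesis by simp
qed

lemma jtp_coeff_eq_0: "\<not> \<bar>n\<bar> \<le> int N \<Longrightarrow> jtp_coeff p N n = 0"
  by (auto simp: jtp_coeff_def rqpoch_def)

lemma finite_jacobi_triple_product:
  assumes p: "norm p < 1" "p \<noteq> 0" and x: "x \<noteq> 0"
  shows "(\<Prod>j<N. (1 - p ^ j * x) * (1 - p ^ (j + 1) / x)) =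
    (\<Sum>n\<in>{- int N..int N}. jtp_coeff p N n * x powi n)"
proof (induction N)
  case 0
  then show ?case by (simp add: jtp_coeff_def rqpoch_def qpoch_def tri_def)
next
  case (Suc N)
  define S where "S = (\<Sum>n\<in>{- int N..int N}. jtp_coeff p N n * x powi n)"
  \<comment> \<open>Coefficients vanish beyond |n| = N, so over the larger range \<open>D\<close> a
    shift of their index by one merely multiplies the sum by x or 1/x.\<close>
  define D where "D = {- int (Suc N)..int (Suc N)}"
  have S0: "(\<Sum>n\<in>D. jtp_coeff p N n * x powi n) = S"
    unfolding S_def D_def by (rule sum.mono_neutral_right) (auto simp: jtp_coeff_eq_0)
  have S1: "(\<Sum>n\<in>D. jtp_coeff p N (n - 1) * x powi n) = x * S"
  proof -
    have "(\<Sum>n\<in>D. jtp_coeff p N (n - 1) * x powi n) =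
        (\<Sum>n\<in>{- int N - 2..int N}. x * (jtp_coeff p N n * x powi n))"
      unfolding D_def using x
      by (intro sum.reindex_bij_witness[of _ "\<lambda>n. n + 1" "\<lambda>n. n - 1"])
        (auto simp: power_int_diff)
    also have "\<dots> = x * S" unfolding S_def sum_distrib_left
      by (rule sum.mono_neutral_right) (auto simp: jtp_coeff_eq_0)
    finally show ?thesis .
  qed
  have S2: "(\<Sum>n\<in>D. jtp_coeff p N (n + 1) * x powi n) = S / x"
  proof -
    have "(\<Sum>n\<in>D. jtp_coeff p N (n + 1) * x powi n) =
        (\<Sum>n\<in>{- int N..int N + 2}. (jtp_coeff p N n * x powi n) / x)"
      unfolding D_def using x
      by (intro sum.reindex_bij_witness[of _ "\<lambda>n. n - 1" "\<lambda>n. n + 1"])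
        (auto simp: power_int_add)
    also have "\<dots> = S / x" unfolding S_def sum_divide_distrib
      by (rule sum.mono_neutral_right) (auto simp: jtp_coeff_eq_0)
    finally show ?thesis .
  qed
  have "(\<Sum>n\<in>D. jtp_coeff p (Suc N) n * x powi n) =
      (1 + p ^ (2 * N + 1)) * (\<Sum>n\<in>D. jtp_coeff p N n * x powi n)
      - p ^ N * (\<Sum>n\<in>D. jtp_coeff p N (n - 1) * x powi n)
      - p ^ Suc N * (\<Sum>n\<in>D. jtp_coeff p N (n + 1) * x powi n)"
    unfolding sum_distrib_left sum_subtractf[symmetric] jtp_coeff_Suc[OF p]
    by (intro sum.cong refl) (simp add: algebra_simps)
  also have "\<dots> = S * ((1 - p ^ N * x) * (1 - p ^ (N + 1) / x))"
    unfolding S0 S1 S2 using x by (simp add: field_simps mult_2_right power_add)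
  finally show ?case
    using Suc.IH by (simp add: D_def S_def)
qed

section \<open>The bilateral theta series and the limit of the finite product\<close>

definition theta_series :: "complex \<Rightarrow> complex \<Rightarrow> complex" where
  "theta_series q z = (\<Sum>\<^sub>\<infinity>n. q powi tri n * z powi n)"

text \<open>For n >= 0 the ratio of successive norms tends to 0. The terms with n <= 0 are of the
  same form with q/z in place of z, since tri(-m) = tri(m) + m.\<close>

lemma theta_series_abs_summable:
  fixes q z :: complex
  assumes q: "norm q < 1" "q \<noteq> 0" and z: "z \<noteq> 0"
  shows "(\<lambda>n. norm (q powi tri n * z powi n)) summable_on UNIV"
proof -
  define h where "h w n = norm (q powi tri (int n) * w ^ n)" for w :: complex and n
  have h: "h w summable_on UNIV" for w
  proof -
    have step: "h w (Suc n) = norm w * norm q ^ n * h w n" for n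
      using q tri_Suc[of "int n"]
      by (simp add: h_def power_int_add norm_mult norm_power add.commute)
    have "(\<lambda>n. norm w * norm q ^ n) \<longlonglongrightarrow> norm w * 0"
      using q by (intro tendsto_intros LIMSEQ_power_zero) auto
    then have "eventually (\<lambda>n. norm w * norm q ^ n < 1 / 2) sequentially"
      by (rule order_tendstoD) simp
    then obtain N where N: "\<And>n. n \<ge> N \<Longrightarrow> norm w * norm q ^ n < 1 / 2"
      by (auto simp: eventually_sequentially)
    have "summable (h w)"
    proof (rule summable_ratio_test[of "1/2" N])
      fix n assume "n \<ge> N"
      then show "norm (h w (Suc n)) \<le> 1 / 2 * norm (h w n)"
        using N[of n] unfolding step real_norm_def abs_mult
        by (intro mult_right_mono) (auto simp: h_def)
    qed simp
    then show ?thesis by (intro norm_summable_imp_summable_on) (simp add: h_def[abs_def])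
  qed
  define f where "f n = norm (q powi tri n * z powi n)" for n
  have "f summable_on range int"
  proof -
    have "f \<circ> int = h z" by (simp add: fun_eq_iff f_def h_def)
    then show ?thesis using h[of z] by (simp add: summable_on_reindex)
  qed
  moreover have "f summable_on range (\<lambda>m. - int m)"
  proof -
    have "f (- int m) = h (q / z) m" for m
    proof -
      have "tri (- int m) = tri (int m) + int m"
        using two_tri[of "- int m"] two_tri[of "int m"] by (simp add: algebra_simps)
      then show ?thesis
        using q z by (simp add: f_def h_def power_int_add power_int_minus power_divide field_simps)
    qed
    then show ?thesis
      using h[of "q / z"] by (subst summable_on_reindex) (auto simp: o_def inj_on_def)
  qed
  ultimately have "f summable_on (range int \<union> range (\<lambda>m. - int m))"
    by (rule summable_on_union)
  also have "range int \<union> range (\<lambda>m. - int m) = UNIV"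
  proof -
    have "n \<in> range int \<union> range (\<lambda>m. - int m)" for n by (cases n rule: int_cases2) auto
    then show ?thesis by blast
  qed
  finally show ?thesis by (simp only: f_def)
qed

lemma theta_series_has_sum:
  assumes "norm q < 1" "q \<noteq> 0" "z \<noteq> 0"
  shows "((\<lambda>n. q powi tri n * z powi n) has_sum theta_series q z) UNIV"
  unfolding theta_series_def
  by (rule has_sum_infsum[OF abs_summable_summable[OF theta_series_abs_summable[OF assms]]])

text \<open>Tannery's theorem, carried over from series over the naturals along the bijection
  \<open>int_decode\<close>.\<close>

lemma tendsto_infsum_dominated:
  fixes a :: "nat \<Rightarrow> int \<Rightarrow> complex"
  assumes lim: "\<And>k. (\<lambda>n. a n k) \<longlonglongrightarrow> b k"
    and bound: "\<And>n k. norm (a n k) \<le> M k"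
    and M: "M summable_on UNIV"
  shows "(\<lambda>n. \<Sum>\<^sub>\<infinity>k. a n k) \<longlonglongrightarrow> (\<Sum>\<^sub>\<infinity>k. b k)"
proof -
  have bij: "bij int_decode" by (rule bij_int_decode)
  have M': "(\<lambda>k. M (int_decode k)) summable_on UNIV"
    using M summable_on_reindex_bij_betw[OF bij, of M] by simp
  have "norm (b k) \<le> M k" for k
    by (rule LIMSEQ_le_const2[OF tendsto_norm[OF lim]]) (use bound in auto)
  then have sb: "(\<lambda>k. b (int_decode k)) summable_on UNIV" 
    by (intro abs_summable_summable[OF Infinite_Sum.abs_summable_on_comparison_test'[OF M']])
  have sa: "(\<lambda>k. a n (int_decode k)) summable_on UNIV" for n
    using bound by (intro abs_summable_summable[OF Infinite_Sum.abs_summable_on_comparison_test'[OF M']])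
  have eq: "(\<Sum>\<^sub>\<infinity>k. f k) = (\<Sum>k. f (int_decode k))"
    if "(\<lambda>k. f (int_decode k)) summable_on UNIV" for f :: "int \<Rightarrow> complex"
  proof -
    have "(\<Sum>\<^sub>\<infinity>k. f k) = (\<Sum>\<^sub>\<infinity>k. f (int_decode k))"
      using infsum_reindex_bij_betw[OF bij, of f] by simp
    also have "\<dots> = (\<Sum>k. f (int_decode k))"
      using has_sum_imp_sums[OF has_sum_infsum[OF that]] by (simp add: sums_iff)
    finally show ?thesis .
  qed
  have "eventually (\<lambda>(k, n). norm (a n (int_decode k)) \<le> M (int_decode k)) (at_top \<times>\<^sub>F sequentially)"
    using bound by (intro always_eventually) auto
  then have "(\<lambda>n. \<Sum>k. a n (int_decode k)) \<longlonglongrightarrow> (\<Sum>k. b (int_decode k))"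
    using tannerys_theorem[of "\<lambda>k n. a n (int_decode k)" "\<lambda>k. b (int_decode k)" sequentially
        "\<lambda>k. M (int_decode k)", OF lim _ summable_on_imp_summable[OF M']] by simp
  then show ?thesis using eq[OF sa] eq[OF sb] by simp
qed

lemma qpoch_tendsto:
  assumes "norm p < 1"
  obtains L where "L \<noteq> 0" "qpoch p \<longlonglongrightarrow> L"
proof -
  have "summable (\<lambda>j. norm (p ^ Suc j))"
    unfolding norm_power using assms by (subst summable_Suc_iff) (simp add: summable_geometric)
  then have "convergent_prod (\<lambda>j. 1 - p ^ Suc j)"
    by (intro abs_convergent_prod_imp_convergent_prod)
      (simp add: abs_convergent_prod_conv_summable norm_mult)
  then have "qpoch p \<longlonglongrightarrow> prodinf (\<lambda>j. 1 - p ^ Suc j)"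
    unfolding qpoch_def[abs_def]
    by (subst LIMSEQ_lessThan_iff_atMost) (rule convergent_prod_LIMSEQ)
  moreover have "prodinf (\<lambda>j. 1 - p ^ Suc j) \<noteq> 0"
    using \<open>convergent_prod _\<close> one_minus_power_nonzero[OF assms] by (intro prodinf_nonzero) auto
  ultimately show ?thesis using that by blast
qed

text \<open>As N grows, the Gaussian binomials tend to 1/L, where L is the nonzero limit of
  \<open>qpoch p\<close>; hence C = 1/L. Since \<open>qpoch\<close> and \<open>rqpoch\<close> are
  bounded, the limit may be taken inside the sum.\<close>

lemma jacobi_triple_product:
  assumes p: "norm p < 1" "p \<noteq> 0"
  shows "\<exists>C. \<forall>x. x \<noteq> 0 \<longrightarrow> theta p x = C * theta_series p (- x)"
proof -
  obtain L where L: "L \<noteq> 0" "qpoch p \<longlonglongrightarrow> L" using qpoch_tendsto[OF p(1)] .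
  have rL: "(\<lambda>m. 1 / qpoch p m) \<longlonglongrightarrow> 1 / L" using L by (intro tendsto_intros)
  obtain K where K: "\<And>m. norm (qpoch p m) \<le> K"
    using convergent_imp_Bseq[OF convergentI[OF L(2)]] unfolding Bseq_def by blast
  obtain K' where K': "K' > 0" "\<And>m. norm (1 / qpoch p m) \<le> K'"
    using convergent_imp_Bseq[OF convergentI[OF rL]] unfolding Bseq_def by blast
  have rb: "norm (rqpoch p n) \<le> K'" for n
    using K' by (auto simp: rqpoch_def)
  have rlim: "(\<lambda>N. rqpoch p (g N)) \<longlonglongrightarrow> 1 / L" if "filterlim g at_top sequentially" for g
  proof -
    have "filterlim (\<lambda>N. nat (g N)) at_top sequentially"
      using filterlim_compose[OF filterlim_nat_sequentially that] .
    then have "(\<lambda>N. 1 / qpoch p (nat (g N))) \<longlonglongrightarrow> 1 / L"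
      by (rule filterlim_compose[OF rL])
    moreover have "eventually (\<lambda>N. g N \<ge> 0) sequentially"
      using that by (simp add: filterlim_at_top)
    then have "eventually (\<lambda>N. rqpoch p (g N) = 1 / qpoch p (nat (g N))) sequentially"
      by eventually_elim (simp add: rqpoch_def)
    ultimately show ?thesis by (simp add: tendsto_cong)
  qed
  have "theta p x = 1 / L * theta_series p (- x)" if x: "x \<noteq> 0" for x
  proof -
    define a where "a N n = jtp_coeff p N n * x powi n" for N n
    \<comment> \<open>The last factor is left unsimplified because it arises as the limit of the
      three factors of the Gaussian binomial.\<close>
    define b where "b n = p powi tri n * (- x) powi n * (L * (1 / L) * (1 / L))" for n
    have xm: "(- x) powi n = (-1) powi n * x powi n" for n
      using power_int_mult_distrib[of "-1" x n] by simp
    have lim: "(\<lambda>N. a N n) \<longlonglongrightarrow> b n" for n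
    proof -
      have shift: "filterlim (\<lambda>N. int N + m) at_top sequentially" for m
        unfolding filterlim_at_top eventually_sequentially
      proof
        show "\<exists>N. \<forall>k\<ge>N. Z \<le> int k + m" for Z
          by (intro exI[of _ "nat (Z - m)"]) auto
      qed
      have "filterlim (\<lambda>N. int N + n) at_top sequentially" "filterlim (\<lambda>N. int N - n) at_top sequentially"
        using shift[of n] shift[of "- n"] by simp_all
      note l = this[THEN rlim]
      have "(\<lambda>N. qpoch p (2 * N)) \<longlonglongrightarrow> L"
        by (rule filterlim_compose[OF L(2)]) (simp add: filterlim_subseq strict_mono_def)
      then have "(\<lambda>N. p powi tri n * (- x) powi n *
           (qpoch p (2 * N) * rqpoch p (int N + n) * rqpoch p (int N - n))) \<longlonglongrightarrow> b n"
        unfolding b_def by (intro tendsto_intros l)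
      then show ?thesis by (simp add: a_def jtp_coeff_def xm mult_ac)
    qed
    have "(\<lambda>N. \<Sum>\<^sub>\<infinity>n. a N n) \<longlonglongrightarrow> (\<Sum>\<^sub>\<infinity>n. b n)"
    proof (rule tendsto_infsum_dominated[OF lim])
      show "norm (a N n) \<le> norm (p powi tri n * (- x) powi n) * (K * K' * K')" for N n
      proof -
        have "norm (qpoch p (2 * N) * rqpoch p (int N + n) * rqpoch p (int N - n)) \<le> K * K' * K'"
          unfolding norm_mult using K' K[of 0] norm_ge_zero order_trans
          by (intro mult_mono K rb mult_nonneg_nonneg) (auto intro: order_trans[OF norm_ge_zero])
        then have "norm (p powi tri n * (- x) powi n) *
            norm (qpoch p (2 * N) * rqpoch p (int N + n) * rqpoch p (int N - n))
            \<le> norm (p powi tri n * (- x) powi n) * (K * K' * K')"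
          by (intro mult_left_mono) auto
        then show ?thesis
          unfolding norm_mult[symmetric] by (simp add: a_def jtp_coeff_def xm mult_ac)
      qed
      show "(\<lambda>n. norm (p powi tri n * (- x) powi n) * (K * K' * K')) summable_on UNIV"
        using p x by (intro summable_on_cmult_left theta_series_abs_summable) auto
    qed
    moreover have "(\<Sum>\<^sub>\<infinity>n. a N n) = (\<Prod>j<N. (1 - p ^ j * x) * (1 - p ^ (j + 1) / x))" for N
    proof -
      have "(\<Sum>\<^sub>\<infinity>n. a N n) = (\<Sum>\<^sub>\<infinity>n\<in>{- int N..int N}. a N n)"
        by (rule infsum_cong_neutral) (auto simp: a_def jtp_coeff_eq_0)
      then show ?thesis
        using finite_jacobi_triple_product[OF p x] by (simp add: a_def)
    qed
    ultimately have "(\<lambda>N. \<Prod>j<N. (1 - p ^ j * x) * (1 - p ^ (j + 1) / x)) \<longlonglongrightarrow> (\<Sum>\<^sub>\<infinity>n. b n)"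
      by simp
    moreover have "(\<lambda>N. \<Prod>j<N. (1 - p ^ j * x) * (1 - p ^ (j + 1) / x)) \<longlonglongrightarrow> theta p x"
      unfolding theta_def
      by (subst LIMSEQ_lessThan_iff_atMost) (rule convergent_prod_LIMSEQ[OF theta_convergent_prod[OF p(1)]])
    ultimately have "theta p x = (\<Sum>\<^sub>\<infinity>n. b n)" using LIMSEQ_unique by blast
    also have "\<dots> = 1 / L * theta_series p (- x)"
      unfolding b_def theta_series_def using L(1) by (subst infsum_cmult_left') simp
    finally show ?thesis .
  qed
  then show ?thesis by (intro exI allI impI)
qed


section \<open>The product of two theta series\<close>

lemma has_sum_times:
  fixes f :: "'a \<Rightarrow> 'c::{real_normed_field, banach}" and g :: "'b \<Rightarrow> 'c"
  assumes f: "(\<lambda>m. norm (f m)) summable_on A" "(f has_sum F) A"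
    and g: "(\<lambda>n. norm (g n)) summable_on B" "(g has_sum G) B"
  shows "((\<lambda>(m, n). f m * g n) has_sum (F * G)) (A \<times> B)"
proof (rule has_sum_SigmaI)
  show "((\<lambda>n. case (m, n) of (m, n) \<Rightarrow> f m * g n) has_sum (f m * G)) B" for m
    using g(2) by (simp add: has_sum_cmult_right)
  show "((\<lambda>m. f m * G) has_sum (F * G)) A"
    using f(2) by (rule has_sum_cmult_left)
  have "(\<lambda>(m, n). f m * g n) abs_summable_on (A \<times> B)"
    unfolding Infinite_Sum.abs_summable_on_Sigma_iff
    using f(1) g(1) by (auto simp: norm_mult abs_mult infsum_nonneg infsum_cmult_right' intro!: summable_on_cmult_right summable_on_cmult_left)
  then show "(\<lambda>(m, n). f m * g n) summable_on (A \<times> B)"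
    by (rule abs_summable_summable)
qed

lemma theta_series_times:
  assumes q: "norm q < 1" "q \<noteq> 0" and x: "x \<noteq> 0" and y: "y \<noteq> 0"
  shows "((\<lambda>(m, n). (q powi tri m * x powi m) * (q powi tri n * y powi n)) has_sum
           (theta_series q x * theta_series q y)) UNIV"
  using has_sum_times[OF theta_series_abs_summable[OF q x] theta_series_has_sum[OF q x]
      theta_series_abs_summable[OF q y] theta_series_has_sum[OF q y]] by simp

text \<open>
  Index pairs $(m,n)$ of even and odd sum are parametrised by $(s+d,\,s-d)$ and $(s+d,\,s-d+1)$.
\<close>

lemma theta_series_product:
  assumes p: "norm p < 1" "p \<noteq> 0" and x: "x \<noteq> 0" and y: "y \<noteq> 0"
  defines "J \<equiv> theta_series (p\<^sup>2)"
  shows "theta_series p (- (x * y)) * theta_series p (- (x / y)) =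
    J (x\<^sup>2) * J (p * y\<^sup>2) - x / y * (J (p * x\<^sup>2) * J (y\<^sup>2))"
proof -
  have q: "norm (p\<^sup>2) < 1" "p\<^sup>2 \<noteq> 0"
    using p by (auto simp: norm_power power_less_one_iff)
  define h where "h = (\<lambda>(m, n). (p powi tri m * (- (x * y)) powi m) * (p powi tri n * (- (x / y)) powi n))"
  define e :: "int \<times> int \<Rightarrow> int \<times> int" where "e = (\<lambda>(s, d). (s + d, s - d))"
  define o' :: "int \<times> int \<Rightarrow> int \<times> int" where "o' = (\<lambda>(s, d). (s + d, s - d + 1))"
  have inj: "inj e" "inj o'" by (auto simp: inj_def e_def o'_def)
  have sgn: "(- (x * y)) powi m * (- (x / y)) powi n = (-1) powi (m + n) * x powi (m + n) * y powi (m - n)" for m n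
  proof -
    have "- (x * y) = (-1) * x * y" "- (x / y) = (-1) * x / y" by simp_all
    then show ?thesis using x y
      by (simp only: power_int_mult_distrib power_int_divide_distrib) 
         (simp add: power_int_add power_int_diff)
  qed
  have hmn: "h (m, n) = p powi (tri m + tri n) * ((-1) powi (m + n) * x powi (m + n) * y powi (m - n))" for m n
    unfolding sgn[symmetric] h_def using p by (simp add: power_int_add)
  have sq: "z\<^sup>2 powi n = z powi (2 * n)" for z :: complex and n
    by (simp add: power_int_power)
  \<comment> \<open>On pairs of even sum the exponent of p carries an extra d, which is absorbed
    into the argument p y^2.\<close>
  have he: "h (e (s, d)) = ((p\<^sup>2) powi tri s * (x\<^sup>2) powi s) * ((p\<^sup>2) powi tri d * (p * y\<^sup>2) powi d)" for s d
  proof -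
    have "tri (s + d) + tri (s - d) = 2 * tri s + (2 * tri d + d)"
      using two_tri[of "s + d"] two_tri[of "s - d"] two_tri[of s] two_tri[of d]
      by (simp add: algebra_simps)
    moreover have "(-1 :: complex) powi (2 * s) = 1" by (simp add: power_int_mult)
    ultimately show ?thesis
      using p by (simp add: e_def hmn sq power_int_mult_distrib power_int_add mult_2[symmetric])
  qed
  \<comment> \<open>On pairs of odd sum an extra s is absorbed into p x^2; the sign and the odd
    powers x^(2s+1) y^(2d-1) leave the prefactor -x/y.\<close>
  have ho: "h (o' (s, d)) = (- (x / y)) * (((p\<^sup>2) powi tri s * (p * x\<^sup>2) powi s) * ((p\<^sup>2) powi tri d * (y\<^sup>2) powi d))" for s d
  proof -
    have "tri (s + d) + tri (s - d + 1) = 2 * tri s + s + 2 * tri d"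
      using two_tri[of "s + d"] two_tri[of "s - d + 1"] two_tri[of s] two_tri[of d]
      by (simp add: algebra_simps)
    moreover have "(-1 :: complex) powi (2 * s) = 1" by (simp add: power_int_mult)
    moreover have "s + d + (s - d + 1) = 2 * s + 1" "s + d - (s - d + 1) = 2 * d - 1" by simp_all
    ultimately show ?thesis
      using p x y by (simp add: o'_def hmn sq power_int_mult_distrib power_int_add power_int_diff)
  qed
  have he': "h \<circ> e = (\<lambda>(s, d). ((p\<^sup>2) powi tri s * (x\<^sup>2) powi s) * ((p\<^sup>2) powi tri d * (p * y\<^sup>2) powi d))"
    by (auto simp: fun_eq_iff he)
  have ho': "h \<circ> o' = (\<lambda>z. (- (x / y)) * (case z of (s, d) \<Rightarrow> ((p\<^sup>2) powi tri s * (p * x\<^sup>2) powi s) * ((p\<^sup>2) powi tri d * (y\<^sup>2) powi d)))"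
    by (auto simp: fun_eq_iff ho)
  have "(h has_sum (J (x\<^sup>2) * J (p * y\<^sup>2))) (range e)"
    unfolding has_sum_reindex[OF inj(1)] J_def
    using theta_series_times[OF q, of "x\<^sup>2" "p * y\<^sup>2"] x y p
    by (simp add: he')
  moreover have "(h has_sum (- (x / y)) * (J (p * x\<^sup>2) * J (y\<^sup>2))) (range o')"
    unfolding has_sum_reindex[OF inj(2)] J_def
    using has_sum_cmult_right[OF theta_series_times[OF q, of "p * x\<^sup>2" "y\<^sup>2"], of "- (x / y)"] x y p
    by (simp add: ho' case_prod_beta)
  moreover have "range e \<inter> range o' = {}"
    by (auto simp: e_def o'_def) presburger
  ultimately have "(h has_sum (J (x\<^sup>2) * J (p * y\<^sup>2) + (- (x / y)) * (J (p * x\<^sup>2) * J (y\<^sup>2)))) (range e \<union> range o')"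
    by (rule has_sum_Un_disjoint)
  also have "range e \<union> range o' = UNIV"
  proof -
    have "(m, n) \<in> range e \<union> range o'" for m n
    proof (cases "even (m + n)")
      case True
      then have "(m, n) = e ((m + n) div 2, (m - n) div 2)" by (simp add: e_def) presburger
      then show ?thesis by blast
    next
      case False
      then have "(m, n) = o' ((m + n - 1) div 2, (m - n + 1) div 2)" by (simp add: o'_def) presburger
      then show ?thesis by blast
    qed
    then show ?thesis by auto
  qed
  finally have 1: "(h has_sum (J (x\<^sup>2) * J (p * y\<^sup>2) + (- (x / y)) * (J (p * x\<^sup>2) * J (y\<^sup>2)))) UNIV" .
  have 2: "(h has_sum (theta_series p (- (x * y)) * theta_series p (- (x / y)))) UNIV"
    unfolding h_def using x y by (intro theta_series_times p) auto
  show ?thesis using has_sum_unique[OF 2 1] by simp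
qed

text \<open>Every factor with j > 0 is 1, while 0^0 = 1 leaves 1 - x at j = 0. The case p = 0 is
  treated apart because the recurrence behind the triple product divides by p.\<close>

lemma theta_0: "theta 0 x = 1 - x"
proof -
  have "theta 0 x = (\<Prod>j\<in>{0}. (1 - 0 ^ j * x) * (1 - 0 ^ (j + 1) / x))"
    unfolding theta_def by (rule prodinf_finite) (auto simp: power_0_left)
  then show ?thesis by simp
qed

subsection \<open>Factorisation of theta products\<close>

text \<open>The determinant of the plane vectors (A x, B x) and (A y, B y).\<close>

definition wedge :: "('a \<Rightarrow> 'b::comm_ring) \<Rightarrow> ('a \<Rightarrow> 'b) \<Rightarrow> 'a \<Rightarrow> 'a \<Rightarrow> 'b" where
  "wedge A B x y = A x * B y - B x * A y"

text \<open>The even and the odd part of the double series are each a function of x times a function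
  of y, which makes their combination a determinant up to the factor x.\<close>

lemma theta_pm_eq_wedge:
  assumes p: "norm p < 1"
  shows "\<exists>A B. \<forall>x y. x \<noteq> 0 \<longrightarrow> y \<noteq> 0 \<longrightarrow> theta_pm p x y = x * wedge A B x y"
proof (cases "p = 0")
  case True
  \<comment> \<open>Here (1 - xy)(1 - x/y) = x ((x + 1/x) - (y + 1/y)).\<close>
  have "theta_pm p x y = x * wedge (\<lambda>x. x + 1 / x) (\<lambda>_. 1) x y" if "x \<noteq> 0" "y \<noteq> 0" for x y
    using that by (simp add: True theta_pm_def theta_0 wedge_def field_simps)
  then show ?thesis by (intro exI allI impI)
next
  case False
  obtain C where "\<forall>x. x \<noteq> 0 \<longrightarrow> theta p x = C * theta_series p (- x)"
    using jacobi_triple_product[OF p False] ..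
  then have C: "theta p x = C * theta_series p (- x)" if "x \<noteq> 0" for x
    using that by simp
  define J where "J = theta_series (p\<^sup>2)"
  \<comment> \<open>The quotient by x in the first function turns the prefactor x/y of the odd part
    into the common factor x; each function takes one of the two constants C.\<close>
  have "theta_pm p x y = x * wedge (\<lambda>x. C * J (x\<^sup>2) / x) (\<lambda>x. C * J (p * x\<^sup>2)) x y"
    if "x \<noteq> 0" "y \<noteq> 0" for x y
  proof -
    have scale: "C\<^sup>2 * (u * v - x / y * (u' * v')) = x * (C * u / x * (C * v) - C * u' * (C * v' / y))" for u v u' v'
      using that by (simp add: field_simps power2_eq_square)
    have "theta_pm p x y = C\<^sup>2 * (theta_series p (- (x * y)) * theta_series p (- (x / y)))"
      using that by (simp add: theta_pm_def C power2_eq_square)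
    also have "\<dots> = x * wedge (\<lambda>x. C * J (x\<^sup>2) / x) (\<lambda>x. C * J (p * x\<^sup>2)) x y"
      unfolding theta_series_product[OF p False that] J_def[symmetric] wedge_def by (rule scale)
    finally show ?thesis .
  qed
  then show ?thesis by (intro exI allI impI)
qed

subsection \<open>Partial fractions\<close>

lemma wedge_anticommute: "wedge A B x y = - wedge A B y x"
  by (simp add: wedge_def mult.commute)

lemma wedge_self [simp]: "wedge A B x x = 0"
  by (simp add: wedge_def mult.commute)

text \<open>The Pluecker relation for four vectors in a plane; for theta products it amounts to the
  Weierstrass addition formula.\<close>

lemma wedge_three_term:
  "wedge A B x y * wedge A B u v = wedge A B x v * wedge A B u y - wedge A B x u * wedge A B v y"
  by (simp add: wedge_def algebra_simps)

text \<open>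
  Induction on the number of numerator factors: the three-term relation expands one factor in terms
  of two nodes, each of which then cancels from the denominator.
\<close>

lemma wedge_partial_fractions:
  fixes A B :: "'a \<Rightarrow> 'b::field" and z :: "'i \<Rightarrow> 'a" and \<alpha> :: "'t \<Rightarrow> 'a"
  assumes "finite T" "finite S" "card S = card T + 2"
    and "\<And>m s. m \<in> S \<Longrightarrow> s \<in> S \<Longrightarrow> m \<noteq> s \<Longrightarrow> wedge A B (z m) (z s) \<noteq> 0"
  shows "(\<Sum>m\<in>S. (\<Prod>t\<in>T. wedge A B (z m) (\<alpha> t)) / (\<Prod>s\<in>S - {m}. wedge A B (z m) (z s))) = 0"
  using assms
proof (induction T arbitrary: S rule: finite_induct)
  case empty
  then have "card S = 2" by simp
  then obtain u v where S: "S = {u, v}" "u \<noteq> v" by (auto simp: card_2_iff)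
  then have "S - {u} = {v}" "S - {v} = {u}" by auto
  then show ?case
    using S wedge_anticommute[of A B "z u" "z v"] by simp
next
  case (insert t T)
  let ?w = "\<lambda>m s. wedge A B (z m) (z s)"
  define F where "F m = (\<Prod>t\<in>T. wedge A B (z m) (\<alpha> t))" for m
  define D where "D S m = (\<Prod>s\<in>S - {m}. ?w m s)" for S m
  have "\<not> card S \<le> 1" using insert by simp
  then obtain u v where uv: "u \<in> S" "v \<in> S" "u \<noteq> v"
    using insert.prems(1) card_le_Suc0_iff_eq[of S] by auto
  have IH: "(\<Sum>m\<in>S - {v}. F m / D (S - {v}) m) = 0" if "v \<in> S" for v
    unfolding F_def D_def by (rule insert.IH) (use insert that in auto)
  \<comment> \<open>The term m = v vanishes by \<open>wedge_self\<close>; in the other terms the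
    extra factor cancels the node v from the denominator, which leaves the sum over S - {v}.\<close>
  have red: "(\<Sum>m\<in>S. F m * ?w m v / D S m) = 0" if v: "v \<in> S" for v
  proof -
    have "(\<Sum>m\<in>S. F m * ?w m v / D S m) = (\<Sum>m\<in>S - {v}. F m * ?w m v / D S m)"
      using v insert.prems(1) by (simp add: sum.remove)
    also have "\<dots> = (\<Sum>m\<in>S - {v}. F m / D (S - {v}) m)"
    proof (rule sum.cong)
      fix m assume m: "m \<in> S - {v}"
      have "D S m = ?w m v * (\<Prod>s\<in>S - {m} - {v}. ?w m s)"
        unfolding D_def using m v insert.prems(1) by (intro prod.remove) auto
      moreover have "S - {m} - {v} = S - {v} - {m}" by blast
      moreover have "?w m v \<noteq> 0" using m v insert.prems(3) by auto
      ultimately show "F m * ?w m v / D S m = F m / D (S - {v}) m" by (simp add: D_def)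
    qed simp
    finally show ?thesis using IH[OF v] by simp
  qed
  \<comment> \<open>After multiplication by the nonzero \<open>?w u v\<close>, the three-term
    relation moves the new numerator factor from z m to z u and z v, where it no longer depends on
    m.\<close>
  have "?w u v * (\<Sum>m\<in>S. (F m * wedge A B (z m) (\<alpha> t)) / D S m) =
      wedge A B (z u) (\<alpha> t) * (\<Sum>m\<in>S. F m * ?w m v / D S m)
      - wedge A B (z v) (\<alpha> t) * (\<Sum>m\<in>S. F m * ?w m u / D S m)"
    unfolding sum_distrib_left sum_subtractf[symmetric]
  proof (rule sum.cong)
    fix m
    have "?w u v * (F m * wedge A B (z m) (\<alpha> t) / D S m) =
        (wedge A B (z m) (\<alpha> t) * ?w u v) * (F m / D S m)" by simp
    also have "\<dots> = (?w m v * wedge A B (z u) (\<alpha> t) - ?w m u * wedge A B (z v) (\<alpha> t)) * (F m / D S m)"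
      by (subst wedge_three_term) simp
    finally show "?w u v * (F m * wedge A B (z m) (\<alpha> t) / D S m) =
        wedge A B (z u) (\<alpha> t) * (F m * ?w m v / D S m) - wedge A B (z v) (\<alpha> t) * (F m * ?w m u / D S m)"
      by (simp add: algebra_simps diff_divide_distrib)
  qed simp
  also have "\<dots> = 0" using red uv by simp
  finally have "(\<Sum>m\<in>S. (F m * wedge A B (z m) (\<alpha> t)) / D S m) = 0"
    using insert.prems(3)[OF uv] by simp
  then show ?case
    using insert.hyps by (simp add: F_def D_def mult.commute)
qed

subsection \<open>Alternating products\<close>

text \<open>An analogue of the Vandermonde product, with \<open>w (y j) (y i)\<close> in place of y
  j - y i.\<close>

definition pairs_prod :: "('a \<Rightarrow> 'a \<Rightarrow> 'b::comm_ring_1) \<Rightarrow> 'i::linorder set \<Rightarrow> ('i \<Rightarrow> 'a) \<Rightarrow> 'b" where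
  "pairs_prod w T y = (\<Prod>j\<in>T. \<Prod>i | i \<in> T \<and> i < j. w (y j) (y i))"

text \<open>This isolates the dependence on the entry at j. The sign \<sigma> comes from reversing
  the pairs of j with larger indices, so it is the same for all y and q.\<close>

lemma pairs_prod_upd:
  fixes w :: "'a \<Rightarrow> 'a \<Rightarrow> 'b::comm_ring_1" and j :: "'i::linorder"
  assumes T: "finite T" "j \<in> T" and anti: "\<And>a b. w a b = - w b a"
  shows "\<exists>\<sigma>. \<forall>y q. pairs_prod w T (y(j := q)) =
      \<sigma> * (\<Prod>i\<in>T - {j}. w q (y i)) * pairs_prod w (T - {j}) y"
proof (intro exI allI)
  fix y :: "'i \<Rightarrow> 'a" and q :: 'a
  let ?y = "y(j := q)"
  define L where "L = {i \<in> T. i < j}"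
  define U where "U = {i \<in> T. j < i}"
  have fin: "finite L" "finite U" using T by (auto simp: L_def U_def)
  have LU: "T - {j} = L \<union> U" "L \<inter> U = {}" by (auto simp: L_def U_def)
  have below: "(\<Prod>i | i \<in> T \<and> i < j. w (?y j) (?y i)) = (\<Prod>i\<in>L. w q (y i))"
    unfolding L_def by (intro prod.cong) auto
  have above: "(\<Prod>i\<in>U. w (y i) q) = (-1) ^ card U * (\<Prod>i\<in>U. w q (y i))"
  proof -
    have "(\<Prod>i\<in>U. w (y i) q) = (\<Prod>i\<in>U. (-1) * w q (y i))"
      by (intro prod.cong refl) (subst anti, simp)
    then show ?thesis by (simp only: prod.distrib prod_constant)
  qed
  have inner: "(\<Prod>i | i \<in> T \<and> i < k. w (?y k) (?y i)) =
      (if j < k then w (y k) q else 1) * (\<Prod>i | i \<in> T - {j} \<and> i < k. w (y k) (y i))"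
    if k: "k \<in> T - {j}" for k
  proof -
    have rest: "(\<Prod>i | i \<in> T - {j} \<and> i < k. w (?y k) (?y i)) = (\<Prod>i | i \<in> T - {j} \<and> i < k. w (y k) (y i))"
      using k by (intro prod.cong) auto
    show ?thesis
    proof (cases "j < k")
      case True
      then have "{i. i \<in> T \<and> i < k} = insert j {i. i \<in> T - {j} \<and> i < k}" using T by auto
      then show ?thesis using True T k rest by simp
    next
      case False
      then have "{i. i \<in> T \<and> i < k} = {i. i \<in> T - {j} \<and> i < k}" by auto
      then show ?thesis using False rest by simp
    qed
  qed
  have "pairs_prod w T ?y = (\<Prod>i | i \<in> T \<and> i < j. w (?y j) (?y i)) *
      (\<Prod>k\<in>T - {j}. \<Prod>i | i \<in> T \<and> i < k. w (?y k) (?y i))"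
    unfolding pairs_prod_def using T by (rule prod.remove)
  also have "(\<Prod>k\<in>T - {j}. \<Prod>i | i \<in> T \<and> i < k. w (?y k) (?y i)) =
      (\<Prod>k\<in>T - {j}. if j < k then w (y k) q else 1) * pairs_prod w (T - {j}) y"
    unfolding pairs_prod_def prod.distrib[symmetric] by (intro prod.cong inner) auto
  also have "(\<Prod>k\<in>T - {j}. if j < k then w (y k) q else 1) = (\<Prod>i\<in>U. w (y i) q)"
    using T by (subst prod.inter_filter[symmetric]) (auto simp: U_def intro!: prod.cong)
  finally show "pairs_prod w T ?y =
      (-1) ^ card U * (\<Prod>i\<in>T - {j}. w q (y i)) * pairs_prod w (T - {j}) y"
    unfolding below above LU(1) prod.union_disjoint[OF fin LU(2)] by (simp only: mult_ac)
qed

text \<open>The condition \<open>balance\<close> trades the sum over the entry at x for minus the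
  sums over the nodes of the other blocks. For block j the node m and the entry k j range over the
  same set \<open>K j\<close>, and their exchange changes the sign.\<close>

lemma sum_pairs_prod_eq_0:
  fixes w :: "'a \<Rightarrow> 'a \<Rightarrow> 'b::field_char_0" and z :: "'i::linorder \<Rightarrow> 'm \<Rightarrow> 'a"
  assumes T: "finite T" "x \<in> T"
    and anti: "\<And>a b. w a b = - w b a"
    and balance: "\<And>y. (\<Sum>j\<in>T. \<Sum>m\<in>K j. (\<Prod>i\<in>T - {x}. w (z j m) (y i)) * \<phi> j m) = 0"
  shows "(\<Sum>k\<in>PiE T K. pairs_prod w T (\<lambda>j. z j (k j)) * (\<Prod>j\<in>T. \<phi> j (k j))) = 0"
proof -
  define T' where "T' = T - {x}"
  have T': "finite T'" "x \<notin> T'" "T = insert x T'" using T by (auto simp: T'_def)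
  define y where "y k i = z i (k i)" for k i
  \<comment> \<open>Node m of block j is put at position x; for j = x this is the original
    summand.\<close>
  define G where "G k j m = pairs_prod w T ((y k)(x := z j m)) * \<phi> j m * (\<Prod>i\<in>T'. \<phi> i (k i))" for k j m
  obtain \<sigma> where \<sigma>': "\<forall>y q. pairs_prod w T (y(x := q)) =
      \<sigma> * (\<Prod>i\<in>T'. w q (y i)) * pairs_prod w T' y"
    unfolding T'_def using pairs_prod_upd[OF T anti] ..
  note \<sigma> = \<sigma>'[rule_format]
  have G_balance: "(\<Sum>j\<in>T. \<Sum>m\<in>K j. G k j m) = 0" for k
  proof -
    have "(\<Sum>j\<in>T. \<Sum>m\<in>K j. G k j m) = \<sigma> * pairs_prod w T' (y k) * (\<Prod>i\<in>T'. \<phi> i (k i)) *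
        (\<Sum>j\<in>T. \<Sum>m\<in>K j. (\<Prod>i\<in>T'. w (z j m) (y k i)) * \<phi> j m)"
      unfolding G_def \<sigma> sum_distrib_left by (simp add: mult_ac)
    then show ?thesis using balance[of "y k"] by (simp add: T'_def)
  qed
  have G_swap: "(\<Sum>k\<in>PiE T' K. \<Sum>m\<in>K j. G k j m) = 0" if j: "j \<in> T'" for j
  proof -
    obtain \<tau> where \<tau>': "\<forall>y q. pairs_prod w T' (y(j := q)) =
        \<tau> * (\<Prod>i\<in>T' - {j}. w q (y i)) * pairs_prod w (T' - {j}) y"
      using pairs_prod_upd[OF T'(1) j anti] ..
    note \<tau> = \<tau>'[rule_format]
    \<comment> \<open>Apart from the antisymmetric first factor, the right side is symmetric in m
      and k j.\<close>
    have G_eq: "G k j m = w (z j m) (z j (k j)) * (\<phi> j (k j) * \<phi> j m) *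
        ((\<Prod>i\<in>T' - {j}. w (z j m) (y k i)) * (\<Prod>i\<in>T' - {j}. w (z j (k j)) (y k i))) *
        (\<sigma> * \<tau> * pairs_prod w (T' - {j}) (y k) * (\<Prod>i\<in>T' - {j}. \<phi> i (k i)))" for k m
    proof -
      have "(y k)(j := z j (k j)) = y k" by (auto simp: y_def)
      then have pp: "pairs_prod w T' (y k) =
          \<tau> * (\<Prod>i\<in>T' - {j}. w (z j (k j)) (y k i)) * pairs_prod w (T' - {j}) (y k)"
        using \<tau>[of "y k" "z j (k j)"] by simp
      have ykj: "y k j = z j (k j)" by (simp add: y_def)
      show ?thesis
        unfolding G_def \<sigma> prod.remove[OF T'(1) j] pp ykj by (simp only: mult_ac)
    qed
    have swap: "G (k(j := m)) j (k j) = - G k j m" for k m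
    proof -
      have "(\<Prod>i\<in>T' - {j}. w q (y (k(j := m)) i)) = (\<Prod>i\<in>T' - {j}. w q (y k i))" for q
        by (intro prod.cong) (auto simp: y_def)
      moreover have "(\<Prod>i\<in>T' - {j}. \<phi> i ((k(j := m)) i)) = (\<Prod>i\<in>T' - {j}. \<phi> i (k i))"
        by (intro prod.cong) auto
      moreover have "pairs_prod w (T' - {j}) (y (k(j := m))) = pairs_prod w (T' - {j}) (y k)"
        unfolding pairs_prod_def by (intro prod.cong) (auto simp: y_def)
      ultimately show ?thesis
        unfolding G_eq using anti[of "z j m" "z j (k j)"] by (simp add: mult_ac)
    qed
    define Z where "Z = (\<Sum>(k, m)\<in>PiE T' K \<times> K j. G k j m)"
    \<comment> \<open>The involution exchanging m and k j gives Z = -Z, hence Z = 0 in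
      characteristic 0.\<close>
    have "Z = (\<Sum>(k, m)\<in>PiE T' K \<times> K j. - G k j m)"
      unfolding Z_def
      by (rule sum.reindex_bij_witness[of _ "\<lambda>(k, m). (k(j := m), k j)" "\<lambda>(k, m). (k(j := m), k j)"])
        (use j swap in \<open>auto simp: PiE_iff extensional_def\<close>)
    also have "\<dots> = - Z" by (simp add: Z_def case_prod_unfold sum_negf)
    finally have "Z = 0" by simp
    then show ?thesis unfolding Z_def sum.cartesian_product[symmetric] .
  qed
  have "(\<Sum>k\<in>PiE T K. pairs_prod w T (\<lambda>j. z j (k j)) * (\<Prod>j\<in>T. \<phi> j (k j))) =
      (\<Sum>(m, k)\<in>K x \<times> PiE T' K. G k x m)"
  proof -
    have "pairs_prod w T (\<lambda>j. z j ((k(x := m)) j)) * (\<Prod>j\<in>T. \<phi> j ((k(x := m)) j)) = G k x m" for k m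
    proof -
      have "(\<lambda>j. z j ((k(x := m)) j)) = (y k)(x := z x m)" by (auto simp: y_def)
      moreover have "(\<Prod>j\<in>T'. \<phi> j ((k(x := m)) j)) = (\<Prod>j\<in>T'. \<phi> j (k j))"
        using T'(2) by (intro prod.cong) auto
      ultimately show ?thesis using T' by (simp add: G_def)
    qed
    then show ?thesis
      unfolding T'(3) PiE_insert_eq
      by (subst sum.reindex[OF inj_combinator[OF T'(2)]]) (simp add: case_prod_unfold T'(3))
  qed
  also have "\<dots> = (\<Sum>m\<in>K x. \<Sum>k\<in>PiE T' K. G k x m)"
    by (rule sum.cartesian_product[symmetric])
  also have "\<dots> = (\<Sum>k\<in>PiE T' K. \<Sum>m\<in>K x. G k x m)"
    by (rule sum.swap)
  also have "\<dots> = (\<Sum>k\<in>PiE T' K. - (\<Sum>j\<in>T'. \<Sum>m\<in>K j. G k j m))"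
    using G_balance T' by (intro sum.cong) (simp_all add: add_eq_0_iff2)
  also have "\<dots> = - (\<Sum>j\<in>T'. \<Sum>k\<in>PiE T' K. \<Sum>m\<in>K j. G k j m)"
    unfolding sum_negf by (subst sum.swap) simp
  finally show ?thesis using G_swap by simp
qed


text \<open>Each unordered pair occurs in both orders and contributes minus a square; \<epsilon>
  collects the signs.\<close>

lemma prod_ordered_pairs:
  fixes w :: "'a \<Rightarrow> 'a \<Rightarrow> 'b::field"
  assumes T: "finite T" and anti: "\<And>a b. w a b = - w b a"
  shows "\<exists>\<epsilon>. \<epsilon> \<noteq> 0 \<and> (\<forall>y. (\<Prod>j\<in>T. \<Prod>i\<in>T - {j}. w (y j) (y i)) = \<epsilon> * (pairs_prod w T y)\<^sup>2)"
proof (intro exI conjI allI)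
  let ?\<epsilon> = "\<Prod>j\<in>T. (-1 :: 'b) ^ card {i. i \<in> T \<and> i < j}"
  show "?\<epsilon> \<noteq> 0" using T by simp
  fix y :: "'c \<Rightarrow> 'a"
  have "(\<Prod>j\<in>T. \<Prod>i\<in>T - {j}. w (y j) (y i)) =
      (\<Prod>j\<in>T. (\<Prod>i | i \<in> T \<and> i < j. w (y j) (y i)) * (\<Prod>i | i \<in> T \<and> j < i. w (y j) (y i)))"
    using T by (intro prod.cong refl, subst prod.union_disjoint[symmetric]) (auto intro!: prod.cong)
  also have "\<dots> = pairs_prod w T y * (\<Prod>j\<in>T. \<Prod>i | i \<in> T \<and> j < i. w (y j) (y i))"
    by (simp add: pairs_prod_def prod.distrib)
  also have "(\<Prod>j\<in>T. \<Prod>i | i \<in> T \<and> j < i. w (y j) (y i)) =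
      (\<Prod>i\<in>T. \<Prod>j | j \<in> T \<and> j < i. w (y j) (y i))"
    using T T by (rule prod.swap_restrict)
  also have "\<dots> = (\<Prod>i\<in>T. \<Prod>j | j \<in> T \<and> j < i. (-1) * w (y i) (y j))"
    by (intro prod.cong refl) (subst anti, simp)
  also have "\<dots> = ?\<epsilon> * pairs_prod w T y"
    by (simp only: pairs_prod_def prod.distrib prod_constant)
  finally show "(\<Prod>j\<in>T. \<Prod>i\<in>T - {j}. w (y j) (y i)) = ?\<epsilon> * (pairs_prod w T y)\<^sup>2"
    by (simp add: power2_eq_square mult_ac)
qed

subsection \<open>Inverses of triangular matrices\<close>

lemma weight_mono: "vle r k n \<Longrightarrow> weight r k \<le> weight r n"
  unfolding vle_def weight_def by (rule sum_mono) auto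

lemma weight_eq_imp_eq:
  assumes "k \<in> Zvec r" "n \<in> Zvec r" "vle r k n" "weight r k = weight r n"
  shows "k = n"
proof (rule PiE_ext)
  show "k \<in> {1..r} \<rightarrow>\<^sub>E UNIV" "n \<in> {1..r} \<rightarrow>\<^sub>E UNIV" using assms by (auto simp: Zvec_def)
  fix i assume "i \<in> {1..r}"
  moreover have "(\<Sum>i=1..r. n i - k i) = 0"
    using assms(4) by (simp add: weight_def sum_subtractf)
  then have "\<forall>i\<in>{1..r}. n i - k i = 0"
    using assms(3) by (subst (asm) sum_nonneg_eq_0_iff) (auto simp: vle_def)
  ultimately show "k i = n i" by auto
qed

lemma vle_refl: "vle r k k"
  by (simp add: vle_def)

lemma vle_trans: "vle r l k \<Longrightarrow> vle r k n \<Longrightarrow> vle r l n"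
  unfolding vle_def by (meson order_trans)

lemma sum_nat_diff:
  assumes "vle r k n"
  shows "(\<Sum>i=1..r. nat (n i - k i)) = nat (weight r n - weight r k)"
proof -
  have "int (\<Sum>i=1..r. nat (n i - k i)) = (\<Sum>i=1..r. n i - k i)"
    unfolding of_nat_sum using assms by (intro sum.cong) (auto simp: vle_def)
  also have "\<dots> = weight r n - weight r k" by (simp add: weight_def sum_subtractf)
  finally show ?thesis by (metis nat_int)
qed

text \<open>
  The difference $d = gf - 1$ satisfies $fd = 0$, which forces $d = 0$ by forward substitution.
\<close>

lemma left_inverse_if_right_inverse:
  assumes f: "lower_triangular r f" and g: "lower_triangular r g"
    and diag: "\<And>n. n \<in> Zvec r \<Longrightarrow> f n n \<noteq> 0"
    and fg: "\<And>n l. n \<in> Zvec r \<Longrightarrow> l \<in> Zvec r \<Longrightarrow>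
        (\<Sum>k\<in>vinterval r l n. f n k * g k l) = (if n = l then 1 else 0)"
    and n: "n \<in> Zvec r" and l: "l \<in> Zvec r"
  shows "(\<Sum>k\<in>vinterval r l n. g n k * f k l) = (if n = l then 1 else 0)"
proof -
  define d where "d n = (\<Sum>k\<in>vinterval r l n. g n k * f k l) - (if n = l then 1 else 0)" for n
  have fd: "(\<Sum>k\<in>vinterval r l n. f n k * d k) = 0" if n: "n \<in> Zvec r" for n
  proof (cases "vle r l n")
    case True
    have mem: "m \<in> Zvec r" "vle r l m" "vle r m n" if "m \<in> vinterval r l n" for m
      using that by (auto simp: vinterval_def)
    \<comment> \<open>This chain is f(gf) = (fg)f = f, with the sums exchanged over l \<le> m \<le>
      k \<le> n.\<close>
    have "(\<Sum>k\<in>vinterval r l n. f n k * (\<Sum>m\<in>vinterval r l k. g k m * f m l)) =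
        (\<Sum>k\<in>vinterval r l n. \<Sum>m\<in>{m \<in> vinterval r l n. vle r m k}. f n k * g k m * f m l)"
      unfolding sum_distrib_left
      by (intro sum.cong) (auto simp: vinterval_def mult.assoc intro: vle_trans)
    also have "\<dots> = (\<Sum>m\<in>vinterval r l n. \<Sum>k\<in>{k \<in> vinterval r l n. vle r m k}. f n k * g k m * f m l)"
      by (intro sum.swap_restrict finite_vinterval)
    also have "\<dots> = (\<Sum>m\<in>vinterval r l n. (\<Sum>k\<in>vinterval r m n. f n k * g k m) * f m l)"
      unfolding sum_distrib_right
      by (intro sum.cong) (auto simp: vinterval_def intro: vle_trans)
    also have "\<dots> = (\<Sum>m\<in>vinterval r l n. if n = m then f m l else 0)"
      by (intro sum.cong) (use n mem fg in auto)
    also have "\<dots> = f n l"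
      using n True by (simp add: finite_vinterval) (simp add: vinterval_def vle_refl)
    finally have 1: "(\<Sum>k\<in>vinterval r l n. f n k * (\<Sum>m\<in>vinterval r l k. g k m * f m l)) = f n l" .
    have "(\<Sum>k\<in>vinterval r l n. f n k * (if k = l then 1 else 0)) =
        (\<Sum>k\<in>vinterval r l n. if k = l then f n k else 0)"
      by (intro sum.cong) auto
    also have "\<dots> = f n l"
      using l True by (simp add: finite_vinterval) (simp add: vinterval_def vle_refl)
    finally show ?thesis using 1 by (simp add: d_def right_diff_distrib sum_subtractf)
  next
    case False
    then have "vinterval r l n = {}" by (auto simp: vinterval_def intro: vle_trans)
    then show ?thesis by simp
  qed
  have "d n = 0" if "n \<in> Zvec r" for n
    using that
  proof (induction "nat (weight r n - weight r l)" arbitrary: n rule: less_induct)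
    case less
    show ?case
    proof (cases "vle r l n")
      case False
      then have "vinterval r l n = {}" "n \<noteq> l" by (auto simp: vinterval_def vle_refl intro: vle_trans)
      then show ?thesis by (simp add: d_def)
    next
      case True
      have n: "n \<in> vinterval r l n" using less.prems True by (auto simp: vinterval_def vle_refl)
      \<comment> \<open>Every other k in the interval has strictly smaller weight, so only the term
        k = n of fd survives.\<close>
      have "d k = 0" if k: "k \<in> vinterval r l n - {n}" for k
      proof (rule less.hyps)
        have k: "k \<in> Zvec r" "vle r l k" "vle r k n" "k \<noteq> n" using that by (auto simp: vinterval_def)
        then show "k \<in> Zvec r" by simp
        have "weight r k < weight r n"
          using weight_mono[OF k(3)] weight_eq_imp_eq[OF k(1) less.prems k(3)] k(4) by force
        then show "nat (weight r k - weight r l) < nat (weight r n - weight r l)"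
          using weight_mono[OF k(2)] by linarith
      qed
      then have "(\<Sum>k\<in>vinterval r l n. f n k * d k) = f n n * d n"
        using n by (simp add: sum.remove finite_vinterval)
      then show ?thesis using fd[OF less.prems] diag[OF less.prems] by simp
    qed
  qed
  then show ?thesis using n by (simp add: d_def)
qed

subsection \<open>Evaluation of the matrix product\<close>

text \<open>The ranges of t in the numerators of f and g overlap exactly at K = |k|; the extra
  factor cancels the denominator of g at a(|k|). The condition L < N excludes L = K = N, where the
  left side is an empty product but the right side is h K.\<close>

lemma prod_int_split_overlap:
  fixes h :: "int \<Rightarrow> 'b::comm_monoid_mult"
  assumes "L \<le> K" "K \<le> N" "L < N"
  shows "prod h {K..N - 1} * prod h {L + 1..K} = prod h {L + 1..N - 1} * h K"
proof (cases "K = L")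
  case True
  have "{L..N - 1} = insert L {L + 1..N - 1}" using assms by auto
  then show ?thesis using True by (simp add: mult.commute)
next
  case False
  have "{L + 1..K} = insert K {L + 1..K - 1}" "{L + 1..N - 1} = {L + 1..K - 1} \<union> {K..N - 1}"
    using assms False by auto
  then show ?thesis by (simp add: prod.union_disjoint mult_ac)
qed

text \<open>The denominators of f and g run over t > K and t < K, so together they omit just
  K.\<close>

lemma prod_int_split_gap:
  fixes h :: "int \<Rightarrow> 'b::comm_monoid_mult"
  assumes "L \<le> K" "K \<le> N"
  shows "prod h ({L..N} - {K}) = prod h {K + 1..N} * prod h {L..K - 1}"
proof -
  have "{L..N} - {K} = {K + 1..N} \<union> {L..K - 1}" using assms by auto
  then show ?thesis by (simp add: prod.union_disjoint)
qed

text \<open>Each x j occurs equally often above and below. This removes the prefactors x in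
  theta(xy)theta(x/y) = x w(x,y).\<close>

lemma prod_ratio_cancel_rows:
  fixes x :: "'i \<Rightarrow> 'b::field"
  assumes R: "finite R" and x: "\<And>j. j \<in> R \<Longrightarrow> x j \<noteq> 0" and card: "card J = (\<Sum>i\<in>R. card (I i))"
  shows "(\<Prod>j\<in>R. \<Prod>t\<in>J. x j * F j t) / (\<Prod>i\<in>R. \<Prod>j\<in>R. \<Prod>t\<in>I i. x j * H i j t) =
    (\<Prod>j\<in>R. \<Prod>t\<in>J. F j t) / (\<Prod>i\<in>R. \<Prod>j\<in>R. \<Prod>t\<in>I i. H i j t)"
proof -
  have "(\<Prod>i\<in>R. \<Prod>j\<in>R. x j ^ card (I i)) = (\<Prod>j\<in>R. x j ^ card J)"
    unfolding card power_sum by (rule prod.swap)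
  moreover have "(\<Prod>j\<in>R. x j ^ card J) \<noteq> 0" using R x by simp
  ultimately show ?thesis by (simp add: prod.distrib)
qed

section \<open>Both matrices in terms of \<open>wedge\<close>\<close>

locale inversion_setup =
  fixes r :: nat and p :: complex and a :: "int \<Rightarrow> complex" and c :: "nat \<Rightarrow> int \<Rightarrow> complex"
    and A B :: "complex \<Rightarrow> complex"
  assumes a: "\<And>t. a t \<noteq> 0" and c: "\<And>j k. j \<in> {1..r} \<Longrightarrow> c j k \<noteq> 0"
    and generic: "no_zero_denominators r p a c"
    and w: "\<And>x y. x \<noteq> 0 \<Longrightarrow> y \<noteq> 0 \<Longrightarrow> theta_pm p x y = x * wedge A B x y"
begin

abbreviation w :: "complex \<Rightarrow> complex \<Rightarrow> complex" where
  "w \<equiv> wedge A B"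

lemma nonzero_cc:
  assumes i: "i \<in> {1..r}" and j: "j \<in> {1..r}" and ne: "(j, k) \<noteq> (i, t)"
  shows "w (c j k) (c i t) \<noteq> 0"
proof -
  \<comment> \<open>Genericity speaks of whole vectors, so vectors with prescribed components are
    supplied. The condition from f covers i \<noteq> j, and i = j with k < t; the one from g covers
    i = j with t < k.\<close>
  define v where "v s = (\<lambda>i'\<in>{1..r}. if i' = j then k else if i' = i then s else 0)" for s :: int
  define u where "u = (\<lambda>i'\<in>{1..r}. if i' = j then t else 0)"
  have Z: "v s \<in> Zvec r" "u \<in> Zvec r" for s by (auto simp: v_def u_def Zvec_def)
  have nz1: "theta_pm p (c j (k' j)) (c i t) \<noteq> 0"
    if "n' \<in> Zvec r" "k' \<in> Zvec r" "vle r k' n'" "t \<in> {k' i + 1..n' i}" for n' k'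
    using generic i j that unfolding no_zero_denominators_def by blast
  have nz2: "theta_pm p (c j (k' j)) (c i t) \<noteq> 0"
    if "k' \<in> Zvec r" "l' \<in> Zvec r" "vle r l' k'" "t \<in> {l' i..k' i - 1}" for k' l'
    using generic i j that unfolding no_zero_denominators_def by blast
  consider "i \<noteq> j" | "i = j" "k < t" | "i = j" "t < k" using ne by fastforce
  then have "theta_pm p (c j k) (c i t) \<noteq> 0"
  proof cases
    case 1
    then show ?thesis
      using nz1[of "v t" "v (t - 1)"] Z i j by (simp add: v_def vle_def)
  next
    case 2
    then show ?thesis
      using nz1[of u "v 0"] Z i j by (simp add: u_def v_def vle_def)
  next
    case 3
    then show ?thesis
      using nz2[of "v 0" u] Z i j by (simp add: u_def v_def vle_def)
  qed
  then show ?thesis using w[of "c j k" "c i t"] c i j by auto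
qed

lemma nonzero_ca:
  assumes "k \<in> Zvec r" "j \<in> {1..r}"
  shows "w (c j (k j)) (a (weight r k)) \<noteq> 0"
proof -
  have "theta_pm p (c j (k j)) (a (weight r k)) \<noteq> 0"
    using generic assms unfolding no_zero_denominators_def by blast
  then show ?thesis using w[of "c j (k j)" "a (weight r k)"] a c assms by auto
qed

text \<open>For each j, |n| - |k| theta products stand above and equally many below, so the
  prefactors \<open>c j (k j)\<close> cancel.\<close>

lemma f_mat_eq:
  assumes kn: "vle r k n"
  shows "f_mat r p a c n k =
    (\<Prod>j=1..r. \<Prod>t=weight r k..weight r n - 1. w (c j (k j)) (a t)) /
    (\<Prod>i=1..r. \<Prod>j=1..r. \<Prod>t=k i + 1..n i. w (c j (k j)) (c i t))"
proof -
  have "f_mat r p a c n k =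
    (\<Prod>j=1..r. \<Prod>t=weight r k..weight r n - 1. c j (k j) * w (c j (k j)) (a t)) /
    (\<Prod>i=1..r. \<Prod>j=1..r. \<Prod>t=k i + 1..n i. c j (k j) * w (c j (k j)) (c i t))"
    using kn a c by (simp add: f_mat_def w)
  also have "\<dots> = (\<Prod>j=1..r. \<Prod>t=weight r k..weight r n - 1. w (c j (k j)) (a t)) /
    (\<Prod>i=1..r. \<Prod>j=1..r. \<Prod>t=k i + 1..n i. w (c j (k j)) (c i t))"
    using c sum_nat_diff[OF kn] by (intro prod_ratio_cancel_rows) auto
  finally show ?thesis .
qed

text \<open>The pairs i < j contribute \<open>c j (l j) / c j (k j)\<close> to the power j - 1. The
  explicit j-th powers, lowered by one through the prefactors of the theta products next to them,
  contribute the inverse.\<close>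

lemma g_mat_eq:
  assumes lk: "vle r l k"
  shows "g_mat r p a c k l =
    pairs_prod w {1..r} (\<lambda>j. c j (l j)) / pairs_prod w {1..r} (\<lambda>j. c j (k j)) *
    ((\<Prod>j=1..r. w (c j (l j)) (a (weight r l))) / (\<Prod>j=1..r. w (c j (k j)) (a (weight r k)))) *
    ((\<Prod>j=1..r. \<Prod>t=weight r l + 1..weight r k. w (c j (k j)) (a t)) /
     (\<Prod>i=1..r. \<Prod>j=1..r. \<Prod>t=l i..k i - 1. w (c j (k j)) (c i t)))"
proof -
  have pairs: "pairs_prod w {1..r} y = (\<Prod>j=1..r. \<Prod>i=1..<j. w (y j) (y i))" for y
    unfolding pairs_prod_def by (intro prod.cong) auto
  have 1: "(\<Prod>j=1..r. \<Prod>i=1..<j.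
       theta_pm p (c j (l j)) (c i (l i)) / theta_pm p (c j (k j)) (c i (k i))) =
     (\<Prod>j=1..r. (c j (l j) / c j (k j)) ^ (j - 1)) *
     (pairs_prod w {1..r} (\<lambda>j. c j (l j)) / pairs_prod w {1..r} (\<lambda>j. c j (k j)))"
  proof -
    have "(\<Prod>i=1..<j. theta_pm p (c j (l j)) (c i (l i)) / theta_pm p (c j (k j)) (c i (k i))) =
        (c j (l j) / c j (k j)) ^ (j - 1) *
        ((\<Prod>i=1..<j. w (c j (l j)) (c i (l i))) / (\<Prod>i=1..<j. w (c j (k j)) (c i (k i))))"
      if "j \<in> {1..r}" for j
    proof -
      have "(\<Prod>i=1..<j. theta_pm p (c j (l j)) (c i (l i)) / theta_pm p (c j (k j)) (c i (k i))) =
          (\<Prod>i=1..<j. (c j (l j) / c j (k j)) * (w (c j (l j)) (c i (l i)) / w (c j (k j)) (c i (k i))))"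
        using that c by (intro prod.cong) (auto simp: w)
      then show ?thesis by (simp add: prod.distrib prod_dividef power_divide)
    qed
    then have "(\<Prod>j=1..r. \<Prod>i=1..<j.
       theta_pm p (c j (l j)) (c i (l i)) / theta_pm p (c j (k j)) (c i (k i))) =
      (\<Prod>j=1..r. (c j (l j) / c j (k j)) ^ (j - 1) *
        ((\<Prod>i=1..<j. w (c j (l j)) (c i (l i))) / (\<Prod>i=1..<j. w (c j (k j)) (c i (k i)))))"
      by (rule prod.cong[OF refl])
    then show ?thesis unfolding pairs by (simp only: prod.distrib prod_dividef)
  qed
  have 2: "(\<Prod>j=1..r. (c j (k j) ^ j * theta_pm p (c j (l j)) (a (weight r l))) /
           (c j (l j) ^ j * theta_pm p (c j (k j)) (a (weight r k)))) =
     (\<Prod>j=1..r. (c j (k j) / c j (l j)) ^ (j - 1)) *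
     ((\<Prod>j=1..r. w (c j (l j)) (a (weight r l))) / (\<Prod>j=1..r. w (c j (k j)) (a (weight r k))))"
  proof -
    have "(c j (k j) ^ j * theta_pm p (c j (l j)) (a (weight r l))) /
          (c j (l j) ^ j * theta_pm p (c j (k j)) (a (weight r k))) =
        (c j (k j) / c j (l j)) ^ (j - 1) * (w (c j (l j)) (a (weight r l)) / w (c j (k j)) (a (weight r k)))"
      if j: "j \<in> {1..r}" for j
    proof -
      obtain j' where "j = Suc j'" using j by (cases j) auto
      then show ?thesis using j c[of j] a by (simp add: w field_simps)
    qed
    then show ?thesis unfolding prod_dividef[symmetric] prod.distrib[symmetric] by (rule prod.cong[OF refl])
  qed
  have 3: "(\<Prod>j=1..r. \<Prod>t=weight r l + 1..weight r k. theta_pm p (c j (k j)) (a t)) /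
      (\<Prod>i=1..r. \<Prod>j=1..r. \<Prod>t=l i..k i - 1. theta_pm p (c j (k j)) (c i t)) =
    (\<Prod>j=1..r. \<Prod>t=weight r l + 1..weight r k. w (c j (k j)) (a t)) /
     (\<Prod>i=1..r. \<Prod>j=1..r. \<Prod>t=l i..k i - 1. w (c j (k j)) (c i t))"
  proof -
    have "(\<Prod>j=1..r. \<Prod>t=weight r l + 1..weight r k. theta_pm p (c j (k j)) (a t)) /
        (\<Prod>i=1..r. \<Prod>j=1..r. \<Prod>t=l i..k i - 1. theta_pm p (c j (k j)) (c i t)) =
      (\<Prod>j=1..r. \<Prod>t=weight r l + 1..weight r k. c j (k j) * w (c j (k j)) (a t)) /
        (\<Prod>i=1..r. \<Prod>j=1..r. \<Prod>t=l i..k i - 1. c j (k j) * w (c j (k j)) (c i t))"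
      using a c by (simp add: w)
    also have "\<dots> = (\<Prod>j=1..r. \<Prod>t=weight r l + 1..weight r k. w (c j (k j)) (a t)) /
     (\<Prod>i=1..r. \<Prod>j=1..r. \<Prod>t=l i..k i - 1. w (c j (k j)) (c i t))"
      using c sum_nat_diff[OF lk] by (intro prod_ratio_cancel_rows) auto
    finally show ?thesis .
  qed
  have 4: "(\<Prod>j=1..r. (c j (l j) / c j (k j)) ^ (j - 1)) * (\<Prod>j=1..r. (c j (k j) / c j (l j)) ^ (j - 1)) = 1"
    unfolding prod.distrib[symmetric] power_mult_distrib[symmetric]
    using c by (intro prod.neutral) simp
  have assoc: "(x * y) * (x' * z) * u = (x * x') * (y * z * u)" for x y x' z u :: complex
    by (simp add: mult_ac)
  show ?thesis
    unfolding g_mat_def if_P[OF lk] 1 2 3 assoc 4 by simp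
qed


lemma pairs_prod_nonzero: "pairs_prod w {1..r} (\<lambda>j. c j (k j)) \<noteq> 0"
  unfolding pairs_prod_def by (auto simp: nonzero_cc)

section \<open>Nodes and the summands of the matrix product\<close>

definition nodes :: "(nat \<Rightarrow> int) \<Rightarrow> (nat \<Rightarrow> int) \<Rightarrow> (nat \<times> int) set" where
  "nodes l n = (SIGMA i:{1..r}. {l i..n i})"

definition node_coeff :: "(nat \<Rightarrow> int) \<Rightarrow> (nat \<Rightarrow> int) \<Rightarrow> nat \<Rightarrow> int \<Rightarrow> complex" where
  "node_coeff l n j m = (\<Prod>t=weight r l + 1..weight r n - 1. w (c j m) (a t)) /
     (\<Prod>s\<in>nodes l n - {(j, m)}. w (c j m) (c (fst s) (snd s)))"

text \<open>In row i the nodes divide into t > k i, t < k i and t = k i; the last one is dropped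
  only for i = j.\<close>

lemma node_denominator:
  assumes j: "j \<in> {1..r}" and lk: "vle r l k" and kn: "vle r k n"
  shows "(\<Prod>s\<in>nodes l n - {(j, k j)}. w x (c (fst s) (snd s))) =
    (\<Prod>i=1..r. \<Prod>t=k i + 1..n i. w x (c i t)) * (\<Prod>i=1..r. \<Prod>t=l i..k i - 1. w x (c i t)) *
    (\<Prod>i\<in>{1..r} - {j}. w x (c i (k i)))"
proof -
  have bounds: "l i \<le> k i" "k i \<le> n i" if "i \<in> {1..r}" for i
    using lk kn that by (auto simp: vle_def)
  have "nodes l n - {(j, k j)} = (SIGMA i:{1..r}. {l i..n i} - (if i = j then {k j} else {}))"
    unfolding nodes_def by (auto split: if_splits)
  then have "(\<Prod>s\<in>nodes l n - {(j, k j)}. w x (c (fst s) (snd s))) =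
      (\<Prod>i=1..r. \<Prod>t\<in>{l i..n i} - (if i = j then {k j} else {}). w x (c i t))"
    by (simp add: prod.Sigma case_prod_unfold)
  also have "\<dots> = (\<Prod>i=1..r. (\<Prod>t=k i + 1..n i. w x (c i t)) * (\<Prod>t=l i..k i - 1. w x (c i t)) *
      (if i = j then 1 else w x (c i (k i))))"
  proof (rule prod.cong)
    fix i assume i: "i \<in> {1..r}"
    have split: "prod h {l i..n i} = h (k i) * prod h ({l i..n i} - {k i})" for h :: "int \<Rightarrow> complex"
      using bounds[OF i] by (intro prod.remove) auto
    show "(\<Prod>t\<in>{l i..n i} - (if i = j then {k j} else {}). w x (c i t)) =
      (\<Prod>t=k i + 1..n i. w x (c i t)) * (\<Prod>t=l i..k i - 1. w x (c i t)) * (if i = j then 1 else w x (c i (k i)))"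
      using prod_int_split_gap[OF bounds[OF i], of "\<lambda>t. w x (c i t)"] split[of "\<lambda>t. w x (c i t)"]
      by (auto simp: mult_ac)
  qed simp
  also have "(\<Prod>i=1..r. (\<Prod>t=k i + 1..n i. w x (c i t)) * (\<Prod>t=l i..k i - 1. w x (c i t)) *
      (if i = j then 1 else w x (c i (k i)))) =
    (\<Prod>i=1..r. \<Prod>t=k i + 1..n i. w x (c i t)) * (\<Prod>i=1..r. \<Prod>t=l i..k i - 1. w x (c i t)) *
    (\<Prod>i=1..r. if i = j then 1 else w x (c i (k i)))"
    by (simp only: prod.distrib)
  also have "(\<Prod>i=1..r. if i = j then 1 else w x (c i (k i))) = (\<Prod>i\<in>{1..r} - {j}. w x (c i (k i)))"
    using j by (subst prod.remove[of _ j]) auto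
  finally show ?thesis .
qed

text \<open>In the product of the denominators of \<open>node_coeff\<close>, the nodes with t = k i
  yield \<epsilon> V^2 by \<open>prod_ordered_pairs\<close>. The summand itself has V only once
  below, so one factor V is left over in the numerator.\<close>

lemma f_mat_times_g_mat:
  assumes l: "l \<in> Zvec r" and n: "n \<in> Zvec r" and ln: "weight r l < weight r n"
  shows "\<exists>C. \<forall>k\<in>vinterval r l n. f_mat r p a c n k * g_mat r p a c k l =
    C * (pairs_prod w {1..r} (\<lambda>j. c j (k j)) * (\<Prod>j=1..r. node_coeff l n j (k j)))"
proof -
  obtain \<epsilon> where \<epsilon>: "\<epsilon> \<noteq> 0 \<and> (\<forall>y :: nat \<Rightarrow> complex.
      (\<Prod>j=1..r. \<Prod>i\<in>{1..r} - {j}. w (y j) (y i)) = \<epsilon> * (pairs_prod w {1..r} y)\<^sup>2)"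
    using prod_ordered_pairs[of "{1..r}" w, OF finite_atLeastAtMost wedge_anticommute] ..
  define C where "C = \<epsilon> * pairs_prod w {1..r} (\<lambda>j. c j (l j)) * (\<Prod>j=1..r. w (c j (l j)) (a (weight r l)))"
  have "f_mat r p a c n k * g_mat r p a c k l =
    C * (pairs_prod w {1..r} (\<lambda>j. c j (k j)) * (\<Prod>j=1..r. node_coeff l n j (k j)))"
    if "k \<in> vinterval r l n" for k
  proof -
    have k: "k \<in> Zvec r" and lk: "vle r l k" and kn: "vle r k n"
      using that by (auto simp: vinterval_def)
    define V where "V = pairs_prod w {1..r} (\<lambda>j. c j (k j))"
    define V0 where "V0 = pairs_prod w {1..r} (\<lambda>j. c j (l j))"
    define W where "W = (\<Prod>j=1..r. w (c j (k j)) (a (weight r k)))"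
    define W0 where "W0 = (\<Prod>j=1..r. w (c j (l j)) (a (weight r l)))"
    define N1 where "N1 = (\<Prod>j=1..r. \<Prod>t=weight r k..weight r n - 1. w (c j (k j)) (a t))"
    define N2 where "N2 = (\<Prod>j=1..r. \<Prod>t=weight r l + 1..weight r k. w (c j (k j)) (a t))"
    define D1 where "D1 = (\<Prod>i=1..r. \<Prod>j=1..r. \<Prod>t=k i + 1..n i. w (c j (k j)) (c i t))"
    define D2 where "D2 = (\<Prod>i=1..r. \<Prod>j=1..r. \<Prod>t=l i..k i - 1. w (c j (k j)) (c i t))"
    define P where "P = (\<Prod>j=1..r. \<Prod>t=weight r l + 1..weight r n - 1. w (c j (k j)) (a t))"
    define Q where "Q = (\<Prod>j=1..r. \<Prod>s\<in>nodes l n - {(j, k j)}. w (c j (k j)) (c (fst s) (snd s)))"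
    have "V \<noteq> 0" using pairs_prod_nonzero by (simp add: V_def)
    have "W \<noteq> 0" using nonzero_ca[OF k] by (simp add: W_def)
    have N: "N1 * N2 = P * W"
      unfolding N1_def N2_def P_def W_def prod.distrib[symmetric]
      using weight_mono[OF lk] weight_mono[OF kn] ln by (intro prod.cong prod_int_split_overlap refl)
    have Q: "Q = D1 * D2 * (\<epsilon> * V\<^sup>2)"
    proof -
      have "Q = (\<Prod>j=1..r. (\<Prod>i=1..r. \<Prod>t=k i + 1..n i. w (c j (k j)) (c i t)) *
          (\<Prod>i=1..r. \<Prod>t=l i..k i - 1. w (c j (k j)) (c i t)) *
          (\<Prod>i\<in>{1..r} - {j}. w (c j (k j)) (c i (k i))))"
        unfolding Q_def by (intro prod.cong refl node_denominator lk kn)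
      also have "\<dots> = D1 * D2 * (\<Prod>j=1..r. \<Prod>i\<in>{1..r} - {j}. w (c j (k j)) (c i (k i)))"
        unfolding prod.distrib D1_def D2_def
        by (intro arg_cong2[where f = times] prod.swap refl)
      also have "\<dots> = D1 * D2 * (\<epsilon> * V\<^sup>2)"
        using conjunct2[OF \<epsilon>, rule_format, of "\<lambda>j. c j (k j)"] by (simp only: V_def)
      finally show ?thesis .
    qed
    have "(\<Prod>j=1..r. node_coeff l n j (k j)) = P / Q"
      by (simp add: node_coeff_def P_def Q_def prod_dividef)
    moreover have "f_mat r p a c n k * g_mat r p a c k l = N1 / D1 * (V0 / V * (W0 / W) * (N2 / D2))"
      unfolding f_mat_eq[OF kn] g_mat_eq[OF lk] N1_def N2_def D1_def D2_def V_def V0_def W_def W0_def ..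
    moreover have "N1 / D1 * (V0 / V * (W0 / W) * (N2 / D2)) = (N1 * N2) * V0 * W0 / (V * W * (D1 * D2))"
      by (simp add: mult_ac)
    moreover have "\<dots> = P * V0 * W0 / (V * (D1 * D2))"
      unfolding N using \<open>W \<noteq> 0\<close> by simp
    moreover have "\<dots> = \<epsilon> * V0 * W0 * (V * (P / Q))"
      unfolding Q using \<open>V \<noteq> 0\<close> conjunct1[OF \<epsilon>] by (simp add: power2_eq_square mult_ac)
    ultimately show ?thesis by (simp add: C_def V_def V0_def W0_def)
  qed
  then show ?thesis by blast
qed

lemma card_nodes:
  assumes "vle r l n"
  shows "int (card (nodes l n)) = weight r n - weight r l + int r"
proof -
  have "int (card (nodes l n)) = (\<Sum>i=1..r. int (nat (n i - l i + 1)))"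
    unfolding nodes_def by (subst card_SigmaI) (simp_all add: algebra_simps)
  also have "\<dots> = (\<Sum>i=1..r. n i - l i + 1)"
  proof (rule sum.cong)
    fix i assume "i \<in> {1..r}"
    then have "l i \<le> n i" using assms unfolding vle_def by blast
    then show "int (nat (n i - l i + 1)) = n i - l i + 1" by simp
  qed simp
  also have "\<dots> = weight r n - weight r l + int r"
    by (simp add: weight_def sum.distrib sum_subtractf)
  finally show ?thesis .
qed

text \<open>Partial fractions apply because the |n| - |l| + r nodes exceed by two the r - 1 factors
  with y and the |n| - |l| - 1 factors with a.\<close>

lemma node_coeff_balance:
  assumes r: "1 \<le> r" and ln: "vle r l n" "weight r l < weight r n"
  shows "(\<Sum>j=1..r. \<Sum>m=l j..n j. (\<Prod>i\<in>{1..r} - {1}. w (c j m) (y i)) * node_coeff l n j m) = 0"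
proof -
  \<comment> \<open>A disjoint sum of index sets merges the two families of numerator
    factors.\<close>
  define T where "T = ({1..r} - {1}) <+> {weight r l + 1..weight r n - 1}"
  define \<alpha> where "\<alpha> = case_sum y a"
  define z where "z s = c (fst s) (snd s)" for s :: "nat \<times> int"
  have finT: "finite T" and fin: "finite (nodes l n)" by (auto simp: T_def nodes_def)
  have prodT: "(\<Prod>t\<in>T. w x (\<alpha> t)) =
      (\<Prod>i\<in>{1..r} - {1}. w x (y i)) * (\<Prod>t=weight r l + 1..weight r n - 1. w x (a t))" for x
    by (simp add: T_def \<alpha>_def prod.Plus)
  have "(\<Sum>j=1..r. \<Sum>m=l j..n j. (\<Prod>i\<in>{1..r} - {1}. w (c j m) (y i)) * node_coeff l n j m) =
      (\<Sum>s\<in>nodes l n. (\<Prod>t\<in>T. w (z s) (\<alpha> t)) / (\<Prod>s'\<in>nodes l n - {s}. w (z s) (z s')))"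
    unfolding prodT
    by (simp add: nodes_def sum.Sigma node_coeff_def z_def case_prod_unfold)
  also have "\<dots> = 0"
  proof (rule wedge_partial_fractions[OF finT fin])
    have "int (card T) = int r - 1 + (weight r n - weight r l - 1)"
      using r ln(2) by (simp add: T_def card_Plus)
    then show "card (nodes l n) = card T + 2"
      using card_nodes[OF ln(1)] by linarith
    show "w (z s) (z s') \<noteq> 0" if "s \<in> nodes l n" "s' \<in> nodes l n" "s \<noteq> s'" for s s'
      using that unfolding z_def nodes_def by (intro nonzero_cc) (auto simp: prod_eq_iff)
  qed
  finally show ?thesis .
qed

lemma f_mat_g_mat:
  assumes r: "1 \<le> r" and n: "n \<in> Zvec r" and l: "l \<in> Zvec r"
  shows "(\<Sum>k\<in>vinterval r l n. f_mat r p a c n k * g_mat r p a c k l) = (if n = l then 1 else 0)"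
proof -
  consider "n = l" | "n \<noteq> l" "\<not> vle r l n" | "n \<noteq> l" "vle r l n" by blast
  then show ?thesis
  proof cases
    case 1
    have "vinterval r l n = {l}"
    proof -
      have "k = l" if "k \<in> vinterval r l l" for k
        using that l weight_mono[of r l k] weight_mono[of r k l]
        by (intro weight_eq_imp_eq[of k r l]) (auto simp: vinterval_def)
      then show ?thesis using 1 l by (auto simp: vinterval_def vle_refl)
    qed
    then show ?thesis
      using 1 pairs_prod_nonzero[of l] nonzero_ca[OF l] by (simp add: f_mat_eq g_mat_eq vle_refl)
  next
    case 2
    then have "vinterval r l n = {}" by (auto simp: vinterval_def intro: vle_trans)
    then show ?thesis using 2 by simp
  next
    case 3
    then have lt: "weight r l < weight r n"
      using weight_mono[OF 3(2)] weight_eq_imp_eq[OF l n 3(2)] by force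
    obtain C where C: "\<forall>k\<in>vinterval r l n. f_mat r p a c n k * g_mat r p a c k l =
        C * (pairs_prod w {1..r} (\<lambda>j. c j (k j)) * (\<Prod>j=1..r. node_coeff l n j (k j)))"
      using f_mat_times_g_mat[OF l n lt] ..
    have "(\<Sum>k\<in>vinterval r l n. f_mat r p a c n k * g_mat r p a c k l) =
        C * (\<Sum>k\<in>vinterval r l n. pairs_prod w {1..r} (\<lambda>j. c j (k j)) * (\<Prod>j=1..r. node_coeff l n j (k j)))"
      unfolding sum_distrib_left using C by (intro sum.cong) auto
    \<comment> \<open>Block 1 is the one whose sum is traded away; it exists since r >= 1.\<close>
    also have "(\<Sum>k\<in>vinterval r l n. pairs_prod w {1..r} (\<lambda>j. c j (k j)) * (\<Prod>j=1..r. node_coeff l n j (k j))) = 0"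
      unfolding vinterval_eq_PiE
      using r by (intro sum_pairs_prod_eq_0[where w = w and z = c and x = 1 and \<phi> = "node_coeff l n"]
          wedge_anticommute node_coeff_balance 3(2) lt) simp_all
    finally show ?thesis using 3(1) by simp
  qed
qed

end

theorem theorem3p4:
  fixes p :: complex and r :: nat
    and a :: "int \<Rightarrow> complex" and c :: "nat \<Rightarrow> int \<Rightarrow> complex"
  assumes "norm p < 1"
    and "1 \<le> r"
    and "\<And>t. a t \<noteq> 0"
    and "\<And>j k. j \<in> {1..r} \<Longrightarrow> c j k \<noteq> 0"
    and "no_zero_denominators r p a c"
  shows "mutually_inverse r (f_mat r p a c) (g_mat r p a c)"
proof -
  obtain A B where AB: "\<forall>x y. x \<noteq> 0 \<longrightarrow> y \<noteq> 0 \<longrightarrow> theta_pm p x y = x * wedge A B x y"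
    using theta_pm_eq_wedge[OF assms(1)] by (elim exE)
  interpret inversion_setup r p a c A B
    using assms(3-5) AB[rule_format] by unfold_locales
  have tri: "lower_triangular r (f_mat r p a c)" "lower_triangular r (g_mat r p a c)"
    by (simp_all add: lower_triangular_def f_mat_def g_mat_def)
  \<comment> \<open>On the diagonal all products in f are empty, so the entry is 1.\<close>
  have diag: "f_mat r p a c n n \<noteq> 0" for n
    by (simp add: f_mat_eq vle_refl)
  show ?thesis
    unfolding mutually_inverse_def
    by (intro conjI ballI tri f_mat_g_mat[OF assms(2)] left_inverse_if_right_inverse[OF tri diag])
qed

end
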